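(* If the operators $A$ and $B$ satisfy the conditions given in the context and $D(A)=D(B^{1/2})$, then the iteration $$T_{k,m}v_{k+1}^{(m+1)}=\frac12\tau\psi_2(\gamma_{k-1})Av_{k+1}^{(m)}-\tau Nv_{k+1}^{(m)}+\widetilde f_k,\qquad m=0,1,\ldots,\qquad v_{k+1}^{(0)}=\frac{u_k+u_{k-1}}2,$$ for finding $v_{k+1}=(u_{k+1}+u_{k-1})/2$, where $u_k$ is the solution of the three-layer scheme given in the context and $T_{k,m}$, $\widetilde f_k$ are defined there, converges with geometric progression speed; that is, for the errors $Z_{k+1}^{(m)}=B^{1/2}\left(v_{k+1}-v_{k+1}^{(m)}\right)$ one has $\|Z_{k+1}^{(m)}\|\le q^m\|Z_{k+1}^{(0)}\|$ with some $q<1$.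
   Context: Setting. $H$ is a Hilbert space with inner product $(\cdot,\cdot)$ and norm $\|\cdot\|$; $\overline t>0$. $A$ and $B$ are self-adjoint, positively defined (i.e. $(Au,u)\ge m_A\|u\|^2$ on $D(A)$ and $(Bu,u)\ge m_B\|u\|^2$ on $D(B)$ for some constants $m_A,m_B>0$), generally unbounded operators with domains $D(A)$, $D(B)$ everywhere dense in $H$, $D(B)\subset D(A)$, and there is a constant $b_0>0$ with $\|Au\|^2\le b_0^2(Bu,u)$ for all $u\in D(B)$. $\psi_1(s),\psi_2(s),\psi_3(s)$, $s\in[0,+\infty[$, are twice continuously differentiable nonnegative functions, and $\psi_2$ is increasing. $C$ is a linear operator with $D(A)\subset D(C)$ and $\|Cu\|\le a_0\|Au\|$ for all $u\in D(A)$, where $a_0>0$ is a constant. $N$ is a bounded linear operator. $M(\cdot)$ is a nonlinear operator satisfying a Lipschitz condition. $a_1,a_2>0$ are constants. $f(t)$ is a given continuous function on $[0,\overline t]$ with values in $H$. Scheme. With $\tau=\overline t/n$ ($n>1$), $t_k=k\tau$, $f_k=f(t_k)$, $$\frac{u_{k+1}-2u_k+u_{k-1}}{\tau^2}+a_1B\frac{u_{k+1}-u_{k-1}}{2\tau}+a_2B\frac{u_{k+1}+u_{k-1}}{2}+a_{1,k}A\frac{u_{k+1}+u_{k-1}}{2}+d_kA\frac{u_{k+1}+u_{k-1}}{2}+a_{3,k}\frac{u_{k+1}+u_{k-1}}{2}+Cu_k+N\frac{u_{k+1}-u_{k-1}}{2\tau}+M(u_k)=f_k,\qquad k=1,\ldots,n-1,$$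 where, for $j=1,3$, $$\widetilde\psi_j(a,b)=\frac1{b-a}\int_a^b\psi_j(s)\,ds,$$ and $$\gamma_k=\|A^{1/2}u_k\|^2,\quad a_{1,k}=\widetilde\psi_1(\gamma_{k-1},\gamma_{k+1}),\quad d_k=\frac{\psi_2(\gamma_{k+1})-\psi_2(\gamma_{k-1})}{2\tau},\quad a_{3,k}=\widetilde\psi_3\left(\|u_{k-1}\|^2,\|u_{k+1}\|^2\right).$$ Data of the iteration. $$T_{k,m}=\left(2+\tau^2a_{3,k}^{(m)}\right)I+\tau(a_1+\tau a_2)B+\tau b_k^{(m)}A,\qquad b_k^{(m)}=\tau a_{1,k}^{(m)}+\frac12\psi_2\left(\gamma_{k+1}^{(m)}\right),$$ $$a_{1,k}^{(m)}=\widetilde\psi_1\left(\gamma_{k-1},\gamma_{k+1}^{(m)}\right),\quad a_{3,k}^{(m)}=\widetilde\psi_3\left(\|u_{k-1}\|^2,\|u_{k+1}^{(m)}\|^2\right),\quad \gamma_{k+1}^{(m)}=\|A^{1/2}u_{k+1}^{(m)}\|^2,\quad u_{k+1}^{(m)}=2v_{k+1}^{(m)}-u_{k-1},$$ $$\widetilde f_k=\tau\widetilde g_k+\tau a_1Bu_{k-1}+2u_k,\qquad \widetilde g_k=\tau f_k-\tau M(u_k)+Nu_{k-1}-\tau Cu_k.$$ The operator $T_{k,m}$ is self-adjoint and positively defined with range $H$, so each $v_{k+1}^{(m+1)}\in D(B)$ is uniquely determined.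
   Formalization: Proved for n ≥ n0 (τ small), with n0 and q depending only on the data and any R bounding ‖B^{1/2}u_0‖, ‖B^{1/2}u_1‖, ‖(u_1−u_0)/τ‖; for large τ the claim fails (H=ℝ, A=B=I, a_1=a_2=1, ψ_j=0, C=M=0, N=−10, τ=1). *)

theory Defs
  imports "HOL-Analysis.Analysis"
begin

section \<open>Unbounded operators in a Hilbert space\<close>

text \<open>
  An operator with domain \<open>D\<close> is a pair of a set \<open>D\<close> and a total function \<open>T\<close>; the values of
  \<open>T\<close> outside \<open>D\<close> are irrelevant. The Hilbert space is real. A complex one is covered by
  restricting the scalars and taking the real part of the inner product: this changes neither the
  norm nor self-adjointness, positive definiteness or square roots of complex-linear operators.
\<close>

definition linear_op :: "'h::real_vector set \<Rightarrow> ('h \<Rightarrow> 'h) \<Rightarrow> bool" where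
  "linear_op D T \<longleftrightarrow> subspace D \<and>
     (\<forall>x\<in>D. \<forall>y\<in>D. T (x + y) = T x + T y) \<and> (\<forall>c. \<forall>x\<in>D. T (c *\<^sub>R x) = c *\<^sub>R T x)"

definition op_graph :: "'h set \<Rightarrow> ('h \<Rightarrow> 'h) \<Rightarrow> ('h \<times> 'h) set" where
  "op_graph D T = {(y, z). y \<in> D \<and> z = T y}"

text \<open>For dense \<open>D\<close> this is the graph of the adjoint operator.\<close>

definition adjoint_graph :: "'h::real_inner set \<Rightarrow> ('h \<Rightarrow> 'h) \<Rightarrow> ('h \<times> 'h) set" where
  "adjoint_graph D T = {(y, z). \<forall>x\<in>D. inner (T x) y = inner x z}"

definition self_adjoint_op :: "'h::real_inner set \<Rightarrow> ('h \<Rightarrow> 'h) \<Rightarrow> bool" where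
  "self_adjoint_op D T \<longleftrightarrow>
     linear_op D T \<and> closure D = UNIV \<and> adjoint_graph D T = op_graph D T"

definition positive_definite_op :: "'h::real_inner set \<Rightarrow> ('h \<Rightarrow> 'h) \<Rightarrow> bool" where
  "positive_definite_op D T \<longleftrightarrow> (\<exists>m>0. \<forall>u\<in>D. inner (T u) u \<ge> m * (norm u)\<^sup>2)"

text \<open>
  \<open>S\<close> with domain \<open>DS\<close> is the nonnegative self-adjoint square root of \<open>T\<close>, where \<open>D\<close> is exactly
  the natural domain of \<open>S \<circ> S\<close>. A positive self-adjoint operator has exactly one such root
  (unique on \<open>DS\<close>, and \<open>DS\<close> is itself unique), so this pins down \<open>T\<^sup>1\<^sup>/\<^sup>2\<close> and its domain.
\<close>

definition is_op_sqrt ::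
  "'h::real_inner set \<Rightarrow> ('h \<Rightarrow> 'h) \<Rightarrow> 'h set \<Rightarrow> ('h \<Rightarrow> 'h) \<Rightarrow> bool" where
  "is_op_sqrt D T DS S \<longleftrightarrow>
     self_adjoint_op DS S \<and> (\<forall>u\<in>DS. inner (S u) u \<ge> 0) \<and>
     D = {u \<in> DS. S u \<in> DS} \<and> (\<forall>u\<in>D. T u = S (S u))"

section \<open>Coefficient functions\<close>

text \<open>Twice continuous differentiability on \<open>[0,\<infinity>[\<close>, with one-sided derivatives at \<open>0\<close>.\<close>

definition C2_on_nonneg :: "(real \<Rightarrow> real) \<Rightarrow> bool" where
  "C2_on_nonneg \<psi> \<longleftrightarrow> (\<exists>\<psi>' \<psi>''.
     (\<forall>s\<ge>0. (\<psi> has_real_derivative \<psi>' s) (at s within {0..})) \<and>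
     (\<forall>s\<ge>0. (\<psi>' has_real_derivative \<psi>'' s) (at s within {0..})) \<and>
     continuous_on {0..} \<psi>'')"

text \<open>
  The integral is oriented, so \<open>b < a\<close> is allowed. At \<open>a = b\<close> the quotient is read as its limit
  \<open>\<psi> a\<close>; division by zero would give \<open>0\<close> instead.
\<close>

definition mean_value :: "(real \<Rightarrow> real) \<Rightarrow> real \<Rightarrow> real \<Rightarrow> real" where
  "mean_value \<psi> a b = (if a = b then \<psi> a else (LBINT s=a..b. \<psi> s) / (b - a))"

section \<open>The three-layer scheme and the iteration\<close>

text \<open>
  \<open>rtA\<close> stands for \<open>A\<^sup>1\<^sup>/\<^sup>2\<close>. All layers lie in \<open>DB\<close>: this is what the occurrences of \<open>B\<close> in the
  equations require.
\<close>

definition solves_scheme ::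
  "(real \<Rightarrow> real) \<Rightarrow> (real \<Rightarrow> real) \<Rightarrow> (real \<Rightarrow> real) \<Rightarrow> real \<Rightarrow> real \<Rightarrow>
   ('h::real_inner \<Rightarrow> 'h) \<Rightarrow> ('h \<Rightarrow> 'h) \<Rightarrow> 'h set \<Rightarrow> ('h \<Rightarrow> 'h) \<Rightarrow>
   ('h \<Rightarrow> 'h) \<Rightarrow> ('h \<Rightarrow> 'h) \<Rightarrow> ('h \<Rightarrow> 'h) \<Rightarrow> (real \<Rightarrow> 'h) \<Rightarrow>
   real \<Rightarrow> nat \<Rightarrow> (nat \<Rightarrow> 'h) \<Rightarrow> bool" where
  "solves_scheme \<psi>1 \<psi>2 \<psi>3 a1 a2 A rtA DB B C N M f \<tau> n u \<longleftrightarrow>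
     (\<forall>k\<le>n. u k \<in> DB) \<and>
     (\<forall>k. 1 \<le> k \<and> k \<le> n - 1 \<longrightarrow>
       (let \<gamma> = (\<lambda>j. (norm (rtA (u j)))\<^sup>2);
            a1k = mean_value \<psi>1 (\<gamma> (k - 1)) (\<gamma> (k + 1));
            d = (\<psi>2 (\<gamma> (k + 1)) - \<psi>2 (\<gamma> (k - 1))) / (2 * \<tau>);
            a3k = mean_value \<psi>3 ((norm (u (k - 1)))\<^sup>2) ((norm (u (k + 1)))\<^sup>2);
            avg = (u (k + 1) + u (k - 1)) /\<^sub>R 2;
            dif = (u (k + 1) - u (k - 1)) /\<^sub>R (2 * \<tau>)
        in (u (k + 1) - 2 *\<^sub>R u k + u (k - 1)) /\<^sub>R \<tau>\<^sup>2
             + a1 *\<^sub>R B dif + a2 *\<^sub>R B avg + a1k *\<^sub>R A avg + d *\<^sub>R A avg + a3k *\<^sub>R avg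
             + C (u k) + N dif + M (u k)
           = f (real k * \<tau>)))"

text \<open>
  The operator of the iteration for the new layer, as it depends on the previous iterate \<open>w\<close> and
  on the layer \<open>u'\<close> preceding the current one.
\<close>

definition iter_op ::
  "(real \<Rightarrow> real) \<Rightarrow> (real \<Rightarrow> real) \<Rightarrow> (real \<Rightarrow> real) \<Rightarrow> real \<Rightarrow> real \<Rightarrow>
   ('h::real_inner \<Rightarrow> 'h) \<Rightarrow> ('h \<Rightarrow> 'h) \<Rightarrow> ('h \<Rightarrow> 'h) \<Rightarrow>
   real \<Rightarrow> 'h \<Rightarrow> 'h \<Rightarrow> 'h \<Rightarrow> 'h" where
  "iter_op \<psi>1 \<psi>2 \<psi>3 a1 a2 A rtA B \<tau> u' w x =
     (let um = 2 *\<^sub>R w - u';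
          \<gamma>m = (norm (rtA um))\<^sup>2;
          a1m = mean_value \<psi>1 ((norm (rtA u'))\<^sup>2) \<gamma>m;
          a3m = mean_value \<psi>3 ((norm u')\<^sup>2) ((norm um)\<^sup>2);
          bm = \<tau> * a1m + 1/2 * \<psi>2 \<gamma>m
      in (2 + \<tau>\<^sup>2 * a3m) *\<^sub>R x + (\<tau> * (a1 + \<tau> * a2)) *\<^sub>R B x + (\<tau> * bm) *\<^sub>R A x)"

definition iter_rhs ::
  "real \<Rightarrow> ('h::real_inner \<Rightarrow> 'h) \<Rightarrow> ('h \<Rightarrow> 'h) \<Rightarrow> ('h \<Rightarrow> 'h) \<Rightarrow> ('h \<Rightarrow> 'h) \<Rightarrow>
   (real \<Rightarrow> 'h) \<Rightarrow> real \<Rightarrow> (nat \<Rightarrow> 'h) \<Rightarrow> nat \<Rightarrow> 'h" where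
  "iter_rhs a1 B C N M f \<tau> u k =
     (let g = \<tau> *\<^sub>R f (real k * \<tau>) - \<tau> *\<^sub>R M (u k) + N (u (k - 1)) - \<tau> *\<^sub>R C (u k)
      in \<tau> *\<^sub>R g + (\<tau> * a1) *\<^sub>R B (u (k - 1)) + 2 *\<^sub>R u k)"

text \<open>\<open>v m\<close> is the \<open>m\<close>-th iterate \<open>v\<^sub>k\<^sub>+\<^sub>1\<^sup>(\<^sup>m\<^sup>)\<close>.\<close>

definition is_iteration ::
  "(real \<Rightarrow> real) \<Rightarrow> (real \<Rightarrow> real) \<Rightarrow> (real \<Rightarrow> real) \<Rightarrow> real \<Rightarrow> real \<Rightarrow>
   ('h::real_inner \<Rightarrow> 'h) \<Rightarrow> ('h \<Rightarrow> 'h) \<Rightarrow> 'h set \<Rightarrow> ('h \<Rightarrow> 'h) \<Rightarrow>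
   ('h \<Rightarrow> 'h) \<Rightarrow> ('h \<Rightarrow> 'h) \<Rightarrow> ('h \<Rightarrow> 'h) \<Rightarrow> (real \<Rightarrow> 'h) \<Rightarrow>
   real \<Rightarrow> (nat \<Rightarrow> 'h) \<Rightarrow> nat \<Rightarrow> (nat \<Rightarrow> 'h) \<Rightarrow> bool" where
  "is_iteration \<psi>1 \<psi>2 \<psi>3 a1 a2 A rtA DB B C N M f \<tau> u k v \<longleftrightarrow>
     v 0 = (u k + u (k - 1)) /\<^sub>R 2 \<and>
     (\<forall>m. v (Suc m) \<in> DB \<and>
          iter_op \<psi>1 \<psi>2 \<psi>3 a1 a2 A rtA B \<tau> (u (k - 1)) (v m) (v (Suc m)) =
            (1/2 * \<tau> * \<psi>2 ((norm (rtA (u (k - 1))))\<^sup>2)) *\<^sub>R A (v m) - \<tau> *\<^sub>R N (v m)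
            + iter_rhs a1 B C N M f \<tau> u k)"

end

theory Submission
  imports Defs
begin

text \<open>
  Testing the scheme with \<open>u\<^sub>k\<^sub>+\<^sub>1 - u\<^sub>k\<^sub>-\<^sub>1\<close> makes every term with \<open>A\<close>, \<open>B\<close> or \<open>\<psi>\<^sub>j\<close> either a difference of
  energies or nonnegative, so a discrete Gronwall inequality bounds \<open>\<parallel>B\<^sup>1\<^sup>/\<^sup>2 u\<^sub>k\<parallel>\<close> uniformly in \<open>k\<close> and
  in the step \<open>\<tau>\<close>. On the resulting bounded sets the coefficients are Lipschitz continuous in
  \<open>\<parallel>B\<^sup>1\<^sup>/\<^sup>2 \<cdot>\<parallel>\<close>, and testing the equation for the error with the new error gives
  \<open>\<parallel>B\<^sup>1\<^sup>/\<^sup>2 z\<^sub>m\<^sub>+\<^sub>1\<parallel>\<^sup>2 \<le> K \<tau> \<parallel>B\<^sup>1\<^sup>/\<^sup>2 z\<^sub>m\<parallel>\<^sup>2\<close>. For small \<open>\<tau>\<close> this is a contraction with ratio \<open>1/2\<close>, which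
  also keeps all iterates in the bounded set.
\<close>

section \<open>Operators\<close>

lemma linear_op_subspace: "linear_op D T \<Longrightarrow> subspace D"
  by (simp add: linear_op_def)

lemma linear_op_add: "linear_op D T \<Longrightarrow> x \<in> D \<Longrightarrow> y \<in> D \<Longrightarrow> T (x + y) = T x + T y"
  by (simp add: linear_op_def)

lemma linear_op_scale: "linear_op D T \<Longrightarrow> x \<in> D \<Longrightarrow> T (c *\<^sub>R x) = c *\<^sub>R T x"
  by (simp add: linear_op_def)

lemma linear_op_diff:
  assumes "linear_op D T" "x \<in> D" "y \<in> D"
  shows "T (x - y) = T x - T y"
proof -
  have "(-1) *\<^sub>R y \<in> D"
    using assms by (intro subspace_scale linear_op_subspace)
  then have "T (x + (-1) *\<^sub>R y) = T x + (-1) *\<^sub>R T y"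
    using assms linear_op_add linear_op_scale by metis
  then show ?thesis by simp
qed

lemma linear_op_restrict:
  assumes "linear_op D T" "subspace E" "E \<subseteq> D"
  shows "linear_op E T"
  using assms unfolding linear_op_def by blast

lemma self_adjoint_op_linear: "self_adjoint_op D T \<Longrightarrow> linear_op D T"
  by (simp add: self_adjoint_op_def)

lemma self_adjoint_op_symmetric:
  assumes "self_adjoint_op D T" "x \<in> D" "y \<in> D"
  shows "inner (T x) y = inner x (T y)"
proof -
  have "(y, T y) \<in> adjoint_graph D T"
    using assms by (simp add: self_adjoint_op_def op_graph_def)
  then show ?thesis
    using assms by (simp add: adjoint_graph_def)
qed

lemma is_op_sqrt_linear:
  assumes "is_op_sqrt D T DS S" "linear_op D T"
  shows "linear_op D S"
  using assms self_adjoint_op_linear linear_op_subspace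
  by (intro linear_op_restrict[of DS S D]) (auto simp: is_op_sqrt_def)

text \<open>One factor \<open>S\<close> moves to the other side by symmetry. This is legitimate
  because \<open>x \<in> D\<close> puts both \<open>x\<close> and \<open>S x\<close> into
  \<open>DS\<close>.\<close>

lemma is_op_sqrt_form:
  assumes "is_op_sqrt D T DS S" "x \<in> D" "y \<in> D"
  shows "inner (T x) y = inner (S x) (S y)"
  using assms self_adjoint_op_symmetric[of DS S "S x" y]
  by (auto simp: is_op_sqrt_def)

lemma inner_sum_diff: "inner (x + y) (x - y) = (norm x)\<^sup>2 - (norm y)\<^sup>2"
  for x y :: "'h::real_inner"
  by (simp add: inner_diff_right inner_add_left power2_norm_eq_inner) (simp add: inner_commute)

text \<open>The difference of squares is the inner product of \<open>x + y\<close> and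
  \<open>x - y\<close>. This turns closeness of two layers into closeness of the arguments of the
  coefficient functions.\<close>

lemma norm_power2_diff_le:
  fixes x y :: "'h::real_inner"
  assumes "norm (x - y) \<le> d" "norm x \<le> r" "norm y \<le> r"
  shows "\<bar>(norm x)\<^sup>2 - (norm y)\<^sup>2\<bar> \<le> 2 * r * d"
proof -
  have "\<bar>(norm x)\<^sup>2 - (norm y)\<^sup>2\<bar> \<le> norm (x + y) * norm (x - y)"
    using Cauchy_Schwarz_ineq2[of "x + y" "x - y"] by (simp add: inner_sum_diff)
  also have "\<dots> \<le> (2 * r) * d"
    using assms norm_triangle_ineq[of x y] norm_ge_zero[of x] norm_ge_zero[of "x - y"]
    by (intro mult_mono) linarith+
  finally show ?thesis .
qed

section \<open>Coefficient functions\<close>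

lemma C2_on_nonneg_continuous:
  assumes "C2_on_nonneg \<psi>"
  shows "continuous_on {0..} \<psi>"
  using assms unfolding C2_on_nonneg_def
  by (auto simp: continuous_on_eq_continuous_within intro: DERIV_continuous)

text \<open>The derivative is continuous, hence bounded on the compact interval. The constant
  depends on \<open>r\<close>; the a priori bounds below supply a suitable \<open>r\<close>.\<close>

lemma C2_on_nonneg_lipschitz:
  assumes "C2_on_nonneg \<psi>"
  obtains K where "K-lipschitz_on {0..r} \<psi>"
proof -
  obtain \<psi>' \<psi>'' where d: "\<forall>s\<ge>0. (\<psi> has_real_derivative \<psi>' s) (at s within {0..})"
    and d': "\<forall>s\<ge>0. (\<psi>' has_real_derivative \<psi>'' s) (at s within {0..})"
    using assms unfolding C2_on_nonneg_def by blast
  have "continuous_on {0..} \<psi>'"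
    using d' by (auto simp: continuous_on_eq_continuous_within intro: DERIV_continuous)
  then have "continuous_on {0..r} \<psi>'"
    by (rule continuous_on_subset) auto
  then have "bounded (\<psi>' ` {0..r})"
    by (intro compact_imp_bounded compact_continuous_image) auto
  then obtain K where K: "K > 0" "\<And>s. s \<in> {0..r} \<Longrightarrow> norm (\<psi>' s) \<le> K"
    by (auto simp: bounded_pos)
  have "norm (\<psi> x - \<psi> y) \<le> K * norm (x - y)" if "x \<in> {0..r}" "y \<in> {0..r}" for x y
  proof (rule field_differentiable_bound[of "{0..r}" \<psi> \<psi>'])
    show "(\<psi> has_field_derivative \<psi>' z) (at z within {0..r})" if "z \<in> {0..r}" for z
      using d that by (auto intro: DERIV_subset)
  qed (use K that in auto)
  then have "K-lipschitz_on {0..r} \<psi>"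
    using K by (intro lipschitz_onI) (auto simp: dist_norm)
  then show ?thesis by (rule that)
qed

section \<open>Oriented means and primitives of the coefficient functions\<close>

lemma continuous_primitive:
  fixes \<psi> :: "real \<Rightarrow> real"
  assumes "continuous_on {0..} \<psi>" "0 \<le> a" "0 \<le> x" "x \<le> b"
  shows "((\<lambda>x. integral {0..x} \<psi>) has_vector_derivative \<psi> x) (at x within {a..b})"
proof -
  have "((\<lambda>x. integral {0..x} \<psi>) has_vector_derivative \<psi> x) (at x within {0..b})"
    by (rule integral_has_vector_derivative)
      (use assms in \<open>auto intro: continuous_on_subset\<close>)
  then show ?thesis
    by (rule has_vector_derivative_within_subset) (use assms in auto)
qed

text \<open>This identity is the point of taking means as coefficients: times the increment of its
  argument, such a coefficient is an exact difference of a primitive. Both sides vanish for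
  \<open>a = b\<close>, and the oriented integral covers \<open>b < a\<close>.\<close>

lemma mean_value_mult_diff:
  assumes "continuous_on {0..} \<psi>" "0 \<le> a" "0 \<le> b"
  shows "mean_value \<psi> a b * (b - a) = integral {0..b} \<psi> - integral {0..a} \<psi>"
proof -
  have "(LBINT s=a..b. \<psi> s) = integral {0..b} \<psi> - integral {0..a} \<psi>"
  proof (rule interval_integral_FTC_finite)
    show "continuous_on {min a b..max a b} \<psi>"
      using assms by (intro continuous_on_subset[OF assms(1)]) auto
  qed (use assms in \<open>auto intro!: continuous_primitive\<close>)
  then show ?thesis
    by (auto simp: mean_value_def)
qed

lemma primitive_mono:
  fixes \<psi> :: "real \<Rightarrow> real"
  assumes "continuous_on {0..} \<psi>" "\<And>s. s \<ge> 0 \<Longrightarrow> \<psi> s \<ge> 0" "a \<le> b"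
  shows "integral {0..a} \<psi> \<le> integral {0..b} \<psi>"
  using assms
  by (intro integral_subset_le)
    (auto intro!: integrable_continuous_interval intro: continuous_on_subset)

lemma primitive_nonneg:
  fixes \<psi> :: "real \<Rightarrow> real"
  assumes "continuous_on {0..} \<psi>" "\<And>s. s \<ge> 0 \<Longrightarrow> \<psi> s \<ge> 0"
  shows "0 \<le> integral {0..b} \<psi>"
  using assms
  by (intro integral_nonneg)
    (auto intro!: integrable_continuous_interval intro: continuous_on_subset)

text \<open>The substitution \<open>a + s * (b - a)\<close> removes the quotient. The case
  \<open>a = b\<close> then needs no separate estimate later, and \<open>b\<close> enters only
  through the integrand.\<close>

lemma mean_value_has_integral:
  assumes "continuous_on {0..} \<psi>" "0 \<le> a" "0 \<le> b"
  shows "((\<lambda>s. \<psi> (a + s * (b - a))) has_integral mean_value \<psi> a b) {0..1}"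
proof (cases "a = b")
  case True
  then show ?thesis
    using has_integral_const_real[of "\<psi> a" 0 1] by (simp add: mean_value_def)
next
  case False
  define I where "I = (\<lambda>x. integral {0..x} \<psi>)"
  have "((\<lambda>s. \<psi> (a + s * (b - a))) has_integral
      I (a + 1 * (b - a)) / (b - a) - I (a + 0 * (b - a)) / (b - a)) {0..1}"
  proof (rule fundamental_theorem_of_calculus)
    fix s :: real assume s: "s \<in> {0..1}"
    \<comment> \<open>The segment between \<open>a\<close> and \<open>b\<close> lies in
      \<open>{0..a + b}\<close> whichever endpoint is larger, and there the derivative of the
      primitive is available.\<close>
    have seg: "0 \<le> a + r * (b - a) \<and> a + r * (b - a) \<le> a + b" if "r \<in> {0..1}" for r
    proof -
      have "a + r * (b - a) = (1 - r) * a + r * b" by (simp add: algebra_simps)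
      moreover have "(1 - r) * a \<le> a" "r * b \<le> b" "0 \<le> (1 - r) * a" "0 \<le> r * b"
        using that assms by (auto intro: mult_left_le_one_le)
      ultimately show ?thesis by linarith
    qed
    have "(I has_real_derivative \<psi> (a + s * (b - a))) (at (a + s * (b - a)) within {0..a + b})"
      using continuous_primitive[of \<psi> 0 "a + s * (b - a)" "a + b"] assms seg[OF s]
      by (simp add: I_def has_real_derivative_iff_has_vector_derivative)
    then have "(I has_real_derivative \<psi> (a + s * (b - a)))
        (at (a + s * (b - a)) within (\<lambda>s. a + s * (b - a)) ` {0..1})"
      by (rule DERIV_subset) (use seg in auto)
    then have "(I \<circ> (\<lambda>s. a + s * (b - a)) has_real_derivative
        \<psi> (a + s * (b - a)) * (b - a)) (at s within {0..1})"
      by (rule DERIV_image_chain) (auto intro!: derivative_eq_intros)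
    then have "((\<lambda>s. (I \<circ> (\<lambda>s. a + s * (b - a))) s / (b - a)) has_real_derivative
        \<psi> (a + s * (b - a)) * (b - a) / (b - a)) (at s within {0..1})"
      by (rule DERIV_cdivide)
    then show "((\<lambda>s. I (a + s * (b - a)) / (b - a)) has_vector_derivative
        \<psi> (a + s * (b - a))) (at s within {0..1})"
      using False by (simp add: has_real_derivative_iff_has_vector_derivative o_def)
  qed simp
  moreover have "I (a + 1 * (b - a)) / (b - a) - I (a + 0 * (b - a)) / (b - a) = mean_value \<psi> a b"
    using mean_value_mult_diff[OF assms, symmetric] False
    by (simp add: I_def flip: diff_divide_distrib)
  ultimately show ?thesis by simp
qed

lemma mean_value_nonneg:
  assumes "continuous_on {0..} \<psi>" "\<And>s. s \<ge> 0 \<Longrightarrow> \<psi> s \<ge> 0" "0 \<le> a" "0 \<le> b"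
  shows "0 \<le> mean_value \<psi> a b"
proof (rule has_integral_nonneg[OF mean_value_has_integral[OF assms(1,3,4)]])
  fix s :: real assume "s \<in> {0..1}"
  then have "0 \<le> (1 - s) * a + s * b" using assms by auto
  then show "0 \<le> \<psi> (a + s * (b - a))"
    using assms(2) by (simp add: algebra_simps)
qed

text \<open>In the integral form over the unit interval the two integrands have arguments at
  distance \<open>s * \<bar>b - c\<bar>\<close> with \<open>s \<le> 1\<close>, so the Lipschitz
  constant of \<open>\<psi>\<close> passes to the mean.\<close>

lemma mean_value_lipschitz:
  assumes "continuous_on {0..} \<psi>" "K-lipschitz_on {0..r} \<psi>"
    and "a \<in> {0..r}" "b \<in> {0..r}" "c \<in> {0..r}"
  shows "\<bar>mean_value \<psi> a b - mean_value \<psi> a c\<bar> \<le> K * \<bar>b - c\<bar>"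
proof -
  let ?d = "\<lambda>s. \<psi> (a + s * (b - a)) - \<psi> (a + s * (c - a))"
  have "(?d has_integral mean_value \<psi> a b - mean_value \<psi> a c) (cbox 0 1)"
    using assms by (auto intro!: has_integral_diff mean_value_has_integral)
  moreover have "norm (?d s) \<le> K * \<bar>b - c\<bar>" if "s \<in> cbox 0 1" for s
  proof -
    have s: "0 \<le> s" "s \<le> 1" using that by auto
    have seg: "a + s * (x - a) \<in> {0..r}" if "x \<in> {0..r}" for x
      using convexD_alt[of "{0..r}" a x s] assms(3) that s
      by (simp add: algebra_simps)
    have K: "0 \<le> K" using assms(2) by (rule lipschitz_on_nonneg)
    have "norm (?d s) \<le> K * \<bar>(a + s * (b - a)) - (a + s * (c - a))\<bar>"
      using lipschitz_onD[OF assms(2) seg seg, of b c] assms by (simp add: dist_norm)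
    also have "\<dots> = s * (K * \<bar>b - c\<bar>)"
      using s by (simp add: abs_mult flip: right_diff_distrib)
    also have "\<dots> \<le> K * \<bar>b - c\<bar>"
      using s K by (intro mult_left_le_one_le) auto
    finally show ?thesis .
  qed
  moreover have "0 \<le> K * \<bar>b - c\<bar>"
    using lipschitz_on_nonneg[OF assms(2)] by simp
  ultimately show ?thesis
    using has_integral_bound[of "K * \<bar>b - c\<bar>" ?d "mean_value \<psi> a b - mean_value \<psi> a c" 0 1]
    by simp
qed

text \<open>The implicit recursion gives
  \<open>(1 - h) * (1 + E k) \<le> (1 + h) * (1 + E (k - 1))\<close>. For \<open>h \<le> 1/2\<close>
  the growth factor of \<open>1 + E k\<close> is at most \<open>1 + 4 * h\<close>, hence at most
  \<open>exp (4 * h)\<close>.\<close>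

lemma discrete_gronwall:
  fixes E :: "nat \<Rightarrow> real"
  assumes "\<And>k. E k \<ge> 0" "0 \<le> h" "h \<le> 1/2"
    and "\<And>k. 1 \<le> k \<Longrightarrow> k \<le> m \<Longrightarrow> E k \<le> E (k - 1) + h * (1 + E k + E (k - 1))"
    and "k \<le> m"
  shows "E k \<le> (1 + E 0) * exp (4 * h * k)"
proof -
  have "1 + E k \<le> (1 + E 0) * (1 + 4 * h) ^ k"
    using \<open>k \<le> m\<close>
  proof (induction k)
    case (Suc k)
    have "(1 - h) * (1 + E (Suc k)) \<le> (1 + h) * (1 + E k)"
      using assms(4)[of "Suc k"] Suc.prems assms(2) by (simp add: algebra_simps)
    also have "\<dots> \<le> ((1 - h) * (1 + 4 * h)) * (1 + E k)"
    proof (rule mult_right_mono)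
      \<comment> \<open>The product \<open>(1 - h) * (1 + 4 * h)\<close> equals
        \<open>1 + 3 * h - 4 * h\<^sup>2\<close>, which is at least \<open>1 + h\<close> because
        \<open>2 * h \<le> 1\<close>.\<close>
      have "h * (2 * h) \<le> h * 1" using assms by (intro mult_left_mono) auto
      then show "1 + h \<le> (1 - h) * (1 + 4 * h)" by (simp add: algebra_simps)
    qed (use assms(1)[of k] in simp)
    finally have "(1 - h) * (1 + E (Suc k)) \<le> (1 - h) * ((1 + 4 * h) * (1 + E k))"
      by (simp add: mult.assoc)
    then have "1 + E (Suc k) \<le> (1 + 4 * h) * (1 + E k)"
      by (rule mult_left_le_imp_le) (use assms in auto)
    also have "\<dots> \<le> (1 + 4 * h) * ((1 + E 0) * (1 + 4 * h) ^ k)"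
      using Suc assms by (intro mult_left_mono) auto
    finally show ?case by (simp add: mult_ac)
  qed simp
  also have "\<dots> \<le> (1 + E 0) * exp (4 * h) ^ k"
    using assms by (intro mult_left_mono power_mono exp_ge_add_one_self)
      (auto simp: add_nonneg_nonneg)
  also have "exp (4 * h) ^ k = exp (4 * h * k)"
    by (rule exp_of_nat2_mult [symmetric])
  finally show ?thesis by simp
qed

section \<open>The scheme\<close>

text \<open>
  Everything takes place on \<open>D(B)\<close>, normed by \<open>\<parallel>B\<^sup>1\<^sup>/\<^sup>2 x\<parallel>\<close>. There \<open>A\<close> and \<open>C\<close> are bounded into \<open>H\<close>,
  because \<open>\<parallel>A x\<parallel>\<^sup>2 \<le> b\<^sub>0\<^sup>2 (B x, x) = b\<^sub>0\<^sup>2 \<parallel>B\<^sup>1\<^sup>/\<^sup>2 x\<parallel>\<^sup>2\<close>.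
\<close>

locale operator_scheme =
  fixes A B C N M rtA rtB :: "'h::real_inner \<Rightarrow> 'h" and DB :: "'h set"
    and \<psi>1 \<psi>2 \<psi>3 :: "real \<Rightarrow> real" and a1 a2 b c \<kappa> \<kappa>A \<mu> L :: real
  assumes lin_A: "linear_op DB A" and lin_B: "linear_op DB B"
    and lin_rtA: "linear_op DB rtA" and lin_rtB: "linear_op DB rtB"
    and A_form: "\<And>x y. x \<in> DB \<Longrightarrow> y \<in> DB \<Longrightarrow> inner (A x) y = inner (rtA x) (rtA y)"
    and B_form: "\<And>x y. x \<in> DB \<Longrightarrow> y \<in> DB \<Longrightarrow> inner (B x) y = inner (rtB x) (rtB y)"
    and norm_A: "\<And>x. x \<in> DB \<Longrightarrow> norm (A x) \<le> b * norm (rtB x)"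
    and norm_C: "\<And>x. x \<in> DB \<Longrightarrow> norm (C x) \<le> c * norm (rtB x)"
    and norm_rtA: "\<And>x. x \<in> DB \<Longrightarrow> norm (rtA x) \<le> \<kappa>A * norm (rtB x)"
    and norm_DB: "\<And>x. x \<in> DB \<Longrightarrow> norm x \<le> \<kappa> * norm (rtB x)"
    and norm_M: "\<And>x. norm (M x) \<le> \<mu> + L * norm x"
    and consts_nonneg: "b \<ge> 0" "c \<ge> 0" "\<kappa> \<ge> 0" "\<kappa>A \<ge> 0" "\<mu> \<ge> 0" "L \<ge> 0"
    and N: "bounded_linear N"
    and C2: "C2_on_nonneg \<psi>1" "C2_on_nonneg \<psi>2" "C2_on_nonneg \<psi>3"
    and psi_nonneg: "\<And>s. s \<ge> 0 \<Longrightarrow> \<psi>1 s \<ge> 0" "\<And>s. s \<ge> 0 \<Longrightarrow> \<psi>2 s \<ge> 0" "\<And>s. s \<ge> 0 \<Longrightarrow> \<psi>3 s \<ge> 0"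
    and psi2_mono: "mono_on {0..} \<psi>2"
    and a1_pos: "a1 > 0" and a2_pos: "a2 > 0"
begin

lemmas sub = linear_op_subspace[OF lin_B]
lemmas cont = C2[THEN C2_on_nonneg_continuous]

lemma DB_closed [intro, simp]:
  assumes "x \<in> DB"
  shows "y \<in> DB \<Longrightarrow> x + y \<in> DB" "y \<in> DB \<Longrightarrow> x - y \<in> DB" "r *\<^sub>R x \<in> DB"
  using assms sub by (auto intro: subspace_add subspace_diff subspace_scale)

text \<open>Symmetry of the form cancels the mixed terms. For the layers \<open>k + 1\<close> and
  \<open>k - 1\<close> this turns the averaged operator terms of the scheme into differences of
  energies.\<close>

lemma inner_op_add_diff:
  assumes "linear_op DB T" "linear_op DB S"
    and form: "\<And>x y. x \<in> DB \<Longrightarrow> y \<in> DB \<Longrightarrow> inner (T x) y = inner (S x) (S y)"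
    and "x \<in> DB" "w \<in> DB"
  shows "inner (T (x + w)) (x - w) = (norm (S x))\<^sup>2 - (norm (S w))\<^sup>2"
proof -
  have "inner (T (x + w)) (x - w) = inner (S x + S w) (S x - S w)"
    using assms by (simp add: linear_op_add[OF assms(2)] linear_op_diff[OF assms(2)])
  then show ?thesis by (simp add: inner_sum_diff)
qed

section \<open>Discrete energy and the a priori bound\<close>

text \<open>Kinetic energy of the difference quotient plus potential energies of two adjacent
  layers. The scheme averages over the layers \<open>k + 1\<close> and \<open>k - 1\<close>; with
  both layers in the sum, the shared middle layer cancels between consecutive energies. The terms
  with \<open>a1\<close> and \<open>\<psi>2\<close> are dissipative and contribute no
  potential.\<close>

definition energy :: "'h \<Rightarrow> 'h \<Rightarrow> real \<Rightarrow> real" where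
  "energy x y \<tau> = (norm ((x - y) /\<^sub>R \<tau>))\<^sup>2 + a2 / 2 * ((norm (rtB x))\<^sup>2 + (norm (rtB y))\<^sup>2)
     + 1/2 * (integral {0..(norm (rtA x))\<^sup>2} \<psi>1 + integral {0..(norm (rtA y))\<^sup>2} \<psi>1)
     + 1/2 * (integral {0..(norm x)\<^sup>2} \<psi>3 + integral {0..(norm y)\<^sup>2} \<psi>3)"

lemma primitives_nonneg: "0 \<le> integral {0..s} \<psi>1" "0 \<le> integral {0..s} \<psi>3"
  using primitive_nonneg cont psi_nonneg by auto

lemma energy_nonneg: "0 \<le> energy x y \<tau>"
  unfolding energy_def using a2_pos primitives_nonneg
  by (intro add_nonneg_nonneg mult_nonneg_nonneg) auto

lemma rtB_le_energy:
  "a2 / 2 * (norm (rtB x))\<^sup>2 \<le> energy x y \<tau>" "a2 / 2 * (norm (rtB y))\<^sup>2 \<le> energy x y \<tau>"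
proof -
  have "0 \<le> a2 / 2 * (norm (rtB x))\<^sup>2" "0 \<le> a2 / 2 * (norm (rtB y))\<^sup>2"
    using a2_pos by auto
  then show "a2 / 2 * (norm (rtB x))\<^sup>2 \<le> energy x y \<tau>" "a2 / 2 * (norm (rtB y))\<^sup>2 \<le> energy x y \<tau>"
    unfolding energy_def distrib_left
    using primitives_nonneg[of "(norm (rtA x))\<^sup>2"] primitives_nonneg[of "(norm (rtA y))\<^sup>2"]
      primitives_nonneg[of "(norm x)\<^sup>2"] primitives_nonneg[of "(norm y)\<^sup>2"]
      zero_le_power2[of "norm ((x - y) /\<^sub>R \<tau>)"]
    by linarith+
qed

text \<open>The step enters only through the difference quotient, so the bound is uniform in
  \<open>\<tau>\<close>. It serves to bound the energy of the two starting layers.\<close>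

lemma energy_bound:
  assumes "0 \<le> r"
  obtains K where "\<And>x y \<tau>. x \<in> DB \<Longrightarrow> y \<in> DB \<Longrightarrow> norm (rtB x) \<le> r \<Longrightarrow> norm (rtB y) \<le> r \<Longrightarrow>
      norm ((x - y) /\<^sub>R \<tau>) \<le> r \<Longrightarrow> energy x y \<tau> \<le> K"
proof
  fix x y \<tau>
  assume D: "x \<in> DB" "y \<in> DB"
    and r: "norm (rtB x) \<le> r" "norm (rtB y) \<le> r" "norm ((x - y) /\<^sub>R \<tau>) \<le> r"
  have sq: "(norm (rtA z))\<^sup>2 \<le> (\<kappa>A * r)\<^sup>2" "(norm z)\<^sup>2 \<le> (\<kappa> * r)\<^sup>2"
    if "z \<in> DB" "norm (rtB z) \<le> r" for z
    using norm_rtA[OF that(1)] norm_DB[OF that(1)] mult_left_mono[OF that(2)] consts_nonneg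
    by (auto intro!: power_mono intro: order_trans)
  have 1: "integral {0..(norm (rtA z))\<^sup>2} \<psi>1 \<le> integral {0..(\<kappa>A * r)\<^sup>2} \<psi>1"
    "integral {0..(norm z)\<^sup>2} \<psi>3 \<le> integral {0..(\<kappa> * r)\<^sup>2} \<psi>3"
    if "z \<in> DB" "norm (rtB z) \<le> r" for z
    using sq[OF that] cont psi_nonneg by (auto intro: primitive_mono)
  have 2: "(norm (rtB x))\<^sup>2 \<le> r\<^sup>2" "(norm (rtB y))\<^sup>2 \<le> r\<^sup>2" "(norm ((x - y) /\<^sub>R \<tau>))\<^sup>2 \<le> r\<^sup>2"
    using r by (auto intro!: power_mono simp del: norm_scaleR)
  have "a2 / 2 * ((norm (rtB x))\<^sup>2 + (norm (rtB y))\<^sup>2) \<le> a2 / 2 * (r\<^sup>2 + r\<^sup>2)"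
    using 2 a2_pos by (intro mult_left_mono add_mono) auto
  then show "energy x y \<tau> \<le> r\<^sup>2 + a2 / 2 * (r\<^sup>2 + r\<^sup>2)
      + 1/2 * (integral {0..(\<kappa>A * r)\<^sup>2} \<psi>1 + integral {0..(\<kappa>A * r)\<^sup>2} \<psi>1)
      + 1/2 * (integral {0..(\<kappa> * r)\<^sup>2} \<psi>3 + integral {0..(\<kappa> * r)\<^sup>2} \<psi>3)"
    unfolding energy_def using 1[OF D(1) r(1)] 1[OF D(2) r(2)] 2(3)
    by (intro add_mono) auto
qed

text \<open>Here \<open>x\<close>, \<open>y\<close>, \<open>w\<close> are the layers
  \<open>k + 1\<close>, \<open>k\<close>, \<open>k - 1\<close>, and the equation is tested with
  \<open>x - w\<close>. The kinetic and potential terms give the change of energy exactly, the terms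
  with \<open>a1\<close> and \<open>\<psi>2\<close> are nonnegative and dropped, and Young's
  inequality bounds the rest by energies.\<close>

lemma energy_step:
  assumes \<tau>: "\<tau> > 0" and D: "x \<in> DB" "y \<in> DB" "w \<in> DB"
    and eq: "(x - 2 *\<^sub>R y + w) /\<^sub>R \<tau>\<^sup>2
       + a1 *\<^sub>R B ((x - w) /\<^sub>R (2 * \<tau>)) + a2 *\<^sub>R B ((x + w) /\<^sub>R 2)
       + mean_value \<psi>1 ((norm (rtA w))\<^sup>2) ((norm (rtA x))\<^sup>2) *\<^sub>R A ((x + w) /\<^sub>R 2)
       + ((\<psi>2 ((norm (rtA x))\<^sup>2) - \<psi>2 ((norm (rtA w))\<^sup>2)) / (2 * \<tau>)) *\<^sub>R A ((x + w) /\<^sub>R 2)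
       + mean_value \<psi>3 ((norm w)\<^sup>2) ((norm x)\<^sup>2) *\<^sub>R ((x + w) /\<^sub>R 2)
       + C y + N ((x - w) /\<^sub>R (2 * \<tau>)) + M y = g"
    and g: "norm g \<le> F"
  defines "G \<equiv> \<mu> + F" and "H \<equiv> c + L * \<kappa>"
  shows "energy x y \<tau> \<le> energy y w \<tau>
    + \<tau> * (G\<^sup>2 / 2 + (1 + H + onorm N) + H / a2) * (1 + energy x y \<tau> + energy y w \<tau>)"
proof -
  define p where "p = (x - y) /\<^sub>R \<tau>"
  define r where "r = (y - w) /\<^sub>R \<tau>"
  define S where "S = norm (p + r)"
  define Y where "Y = norm (rtB y)"
  define m1 where "m1 = mean_value \<psi>1 ((norm (rtA w))\<^sup>2) ((norm (rtA x))\<^sup>2)"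
  define m3 where "m3 = mean_value \<psi>3 ((norm w)\<^sup>2) ((norm x)\<^sup>2)"
  define dd where "dd = (\<psi>2 ((norm (rtA x))\<^sup>2) - \<psi>2 ((norm (rtA w))\<^sup>2)) / (2 * \<tau>)"
  \<comment> \<open>The lower-order terms have no sign; they are collected in \<open>h\<close> and
    estimated by Cauchy-Schwarz.\<close>
  define h where "h = C y + N ((x - w) /\<^sub>R (2 * \<tau>)) + M y - g"
  define I1 where "I1 = (\<lambda>z. integral {0..(norm (rtA z))\<^sup>2} \<psi>1)"
  define I3 where "I3 = (\<lambda>z::'h. integral {0..(norm z)\<^sup>2} \<psi>3)"
  have F: "0 \<le> F" using g norm_ge_zero order_trans by blast
  have G: "0 \<le> G" and H: "0 \<le> H" and nN: "0 \<le> onorm N" and Y: "0 \<le> Y" and S0: "0 \<le> S"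
    using consts_nonneg F onorm_pos_le[OF N] by (auto simp: G_def H_def Y_def S_def)
  have xw: "x - w = \<tau> *\<^sub>R (p + r)"
    using \<tau> by (simp add: p_def r_def algebra_simps)
  have pr: "(x - 2 *\<^sub>R y + w) /\<^sub>R \<tau>\<^sup>2 = (p - r) /\<^sub>R \<tau>"
    by (simp add: p_def r_def algebra_simps power2_eq_square scaleR_2)
  have t0: "inner ((x - 2 *\<^sub>R y + w) /\<^sub>R \<tau>\<^sup>2) (x - w) = (norm p)\<^sup>2 - (norm r)\<^sup>2"
    unfolding pr unfolding xw using \<tau> inner_sum_diff[of p r]
    by (simp add: inner_commute)
  have B: "B ((x - w) /\<^sub>R (2 * \<tau>)) = B (x - w) /\<^sub>R (2 * \<tau>)" "B ((x + w) /\<^sub>R 2) = B (x + w) /\<^sub>R 2"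
    and A: "A ((x + w) /\<^sub>R 2) = A (x + w) /\<^sub>R 2"
    using D lin_A lin_B by (auto simp: linear_op_scale)
  have t1: "0 \<le> inner (a1 *\<^sub>R B ((x - w) /\<^sub>R (2 * \<tau>))) (x - w)"
    using D a1_pos \<tau> unfolding B by (simp add: B_form)
  have t2: "inner (a2 *\<^sub>R B ((x + w) /\<^sub>R 2)) (x - w)
      = a2 / 2 * ((norm (rtB x))\<^sup>2 - (norm (rtB w))\<^sup>2)"
    using inner_op_add_diff[OF lin_B lin_rtB B_form D(1,3)] unfolding B by simp
  have tA: "inner (A ((x + w) /\<^sub>R 2)) (x - w) = ((norm (rtA x))\<^sup>2 - (norm (rtA w))\<^sup>2) / 2"
    using inner_op_add_diff[OF lin_A lin_rtA A_form D(1,3)] unfolding A by simp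
  have t3: "inner (m1 *\<^sub>R A ((x + w) /\<^sub>R 2)) (x - w) = 1/2 * (I1 x - I1 w)"
    using mean_value_mult_diff[OF cont(1), of "(norm (rtA w))\<^sup>2" "(norm (rtA x))\<^sup>2"]
    unfolding inner_scaleR_left tA by (simp add: m1_def I1_def)
  \<comment> \<open>Monotonicity gives \<open>(\<psi>2 r - \<psi>2 s) * (r - s) \<ge> 0\<close> in
    either order of \<open>r\<close> and \<open>s\<close>, so this term is dissipative.\<close>
  have t4: "0 \<le> inner (dd *\<^sub>R A ((x + w) /\<^sub>R 2)) (x - w)"
  proof -
    have "0 \<le> (\<psi>2 r - \<psi>2 s) * (r - s)" if "0 \<le> r" "0 \<le> s" for r s
      using mono_onD[OF psi2_mono, of s r] mono_onD[OF psi2_mono, of r s] that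
      by (cases "s \<le> r") (auto simp: zero_le_mult_iff)
    from this[of "(norm (rtA x))\<^sup>2" "(norm (rtA w))\<^sup>2"] show ?thesis
      unfolding inner_scaleR_left tA dd_def using \<tau> by simp
  qed
  have "inner ((x + w) /\<^sub>R 2) (x - w) = ((norm x)\<^sup>2 - (norm w)\<^sup>2) / 2"
    by (simp add: inner_sum_diff)
  then have t5: "inner (m3 *\<^sub>R ((x + w) /\<^sub>R 2)) (x - w) = 1/2 * (I3 x - I3 w)"
    using mean_value_mult_diff[OF cont(3), of "(norm w)\<^sup>2" "(norm x)\<^sup>2"]
    by (simp add: m3_def I3_def)
  \<comment> \<open>Since \<open>x - w\<close> carries a factor \<open>\<tau>\<close>, the quotient
    under \<open>N\<close> is half of \<open>p + r\<close>, and no negative power of the step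
    remains.\<close>
  have "N ((x - w) /\<^sub>R (2 * \<tau>)) = N (p + r) /\<^sub>R 2"
    using \<tau> unfolding xw by (simp add: linear_scale[OF bounded_linear.linear[OF N]])
  then have nNd: "norm (N ((x - w) /\<^sub>R (2 * \<tau>))) \<le> onorm N / 2 * S"
    using onorm[OF N, of "p + r"] by (simp add: S_def)
  have "norm (M y) \<le> \<mu> + L * (\<kappa> * Y)"
    using norm_M[of y] mult_left_mono[OF norm_DB[OF D(2)] consts_nonneg(6)] by (simp add: Y_def)
  moreover have "norm h \<le> norm (C y) + norm (N ((x - w) /\<^sub>R (2 * \<tau>))) + norm (M y) + norm g"
    unfolding h_def by (intro norm_triangle_le_diff norm_triangle_mono order_refl add_mono)
  ultimately have hb: "norm h \<le> G + H * Y + onorm N / 2 * S"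
    using norm_C[OF D(2)] nNd g by (simp add: G_def H_def Y_def algebra_simps)
  have "- inner h (x - w) \<le> norm h * norm (x - w)"
    using Cauchy_Schwarz_ineq2[of h "x - w"] by linarith
  also have "norm (x - w) = \<tau> * S"
    using \<tau> by (simp add: xw S_def)
  also have "norm h * (\<tau> * S) \<le> (G + H * Y + onorm N / 2 * S) * (\<tau> * S)"
    using \<tau> S0 hb by (intro mult_right_mono) auto
  finally have th: "- inner h (x - w) \<le> \<tau> * ((G + H * Y + onorm N / 2 * S) * S)"
    by (simp add: mult_ac)
  have "S\<^sup>2 \<le> (norm p + norm r)\<^sup>2"
    unfolding S_def by (intro power_mono norm_triangle_ineq) auto
  moreover have "2 * (norm p * norm r) \<le> (norm p)\<^sup>2 + (norm r)\<^sup>2"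
    using sum_squares_bound[of "norm p" "norm r"] by simp
  ultimately have SS: "S\<^sup>2 \<le> 2 * ((norm p)\<^sup>2 + (norm r)\<^sup>2)"
    by (simp add: power2_sum)
  let ?E = "energy x y \<tau> + energy y w \<tau>"
  have E0: "0 \<le> energy x y \<tau>" "0 \<le> energy y w \<tau>" by (rule energy_nonneg)+
  have "(norm p)\<^sup>2 \<le> energy x y \<tau>" "(norm r)\<^sup>2 \<le> energy y w \<tau>"
    unfolding energy_def p_def r_def using a2_pos primitives_nonneg
    by (simp_all add: add_nonneg_nonneg)
  then have "(norm p)\<^sup>2 + (norm r)\<^sup>2 \<le> ?E" by (rule add_mono)
  then have SE: "S\<^sup>2 / 2 \<le> ?E" using SS by simp
  have YE: "Y\<^sup>2 / 2 \<le> ?E / a2"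
    using rtB_le_energy(2)[where x = x and y = y and \<tau> = \<tau>] E0 a2_pos
    by (simp add: Y_def field_simps)
  have "(G + H * Y + onorm N / 2 * S) * S = G * S + H * (Y * S) + onorm N * (S\<^sup>2 / 2)"
    by (simp add: algebra_simps power2_eq_square)
  \<comment> \<open>Young's inequality for \<open>G * S\<close> and \<open>Y * S\<close> produces
    the summand \<open>G\<^sup>2 / 2\<close>. The summand \<open>H / a2\<close> arises next, where
    \<open>Y\<^sup>2 / 2\<close> is bounded by energies over \<open>a2\<close>.\<close>
  also have "\<dots> \<le> (G\<^sup>2 / 2 + S\<^sup>2 / 2) + H * (Y\<^sup>2 / 2 + S\<^sup>2 / 2) + onorm N * (S\<^sup>2 / 2)"
    using sum_squares_bound[of G S] sum_squares_bound[of Y S] H nN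
    by (intro add_mono mult_left_mono) auto
  also have "\<dots> \<le> (G\<^sup>2 / 2 + ?E) + H * (?E / a2 + ?E) + onorm N * ?E"
    using SE YE H nN by (intro add_mono mult_left_mono) auto
  also have "\<dots> = G\<^sup>2 / 2 + ((1 + H + onorm N) + H / a2) * ?E"
    by (simp add: algebra_simps add_divide_distrib)
  also have "\<dots> \<le> (G\<^sup>2 / 2 + (1 + H + onorm N) + H / a2) * (1 + ?E)"
    using E0 H nN a2_pos by (simp add: algebra_simps add_nonneg_nonneg)
  finally have *: "(G + H * Y + onorm N / 2 * S) * S
      \<le> (G\<^sup>2 / 2 + (1 + H + onorm N) + H / a2) * (1 + ?E)" .
  have "(x - 2 *\<^sub>R y + w) /\<^sub>R \<tau>\<^sup>2
       + a1 *\<^sub>R B ((x - w) /\<^sub>R (2 * \<tau>)) + a2 *\<^sub>R B ((x + w) /\<^sub>R 2)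
       + m1 *\<^sub>R A ((x + w) /\<^sub>R 2) + dd *\<^sub>R A ((x + w) /\<^sub>R 2) + m3 *\<^sub>R ((x + w) /\<^sub>R 2) + h = 0"
    using eq unfolding h_def m1_def m3_def dd_def by (simp add: algebra_simps)
  then have "inner ((x - 2 *\<^sub>R y + w) /\<^sub>R \<tau>\<^sup>2) (x - w)
       + inner (a1 *\<^sub>R B ((x - w) /\<^sub>R (2 * \<tau>))) (x - w) + inner (a2 *\<^sub>R B ((x + w) /\<^sub>R 2)) (x - w)
       + inner (m1 *\<^sub>R A ((x + w) /\<^sub>R 2)) (x - w) + inner (dd *\<^sub>R A ((x + w) /\<^sub>R 2)) (x - w)
       + inner (m3 *\<^sub>R ((x + w) /\<^sub>R 2)) (x - w) + inner h (x - w) = 0"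
    by (metis inner_add_left inner_zero_left)
  then have "(norm p)\<^sup>2 - (norm r)\<^sup>2 + a2 / 2 * ((norm (rtB x))\<^sup>2 - (norm (rtB w))\<^sup>2)
      + 1/2 * (I1 x - I1 w) + 1/2 * (I3 x - I3 w) \<le> - inner h (x - w)"
    using t1 t4 unfolding t0 t2 t3 t5 by linarith
  moreover have "energy x y \<tau> - energy y w \<tau> = (norm p)\<^sup>2 - (norm r)\<^sup>2
      + a2 / 2 * ((norm (rtB x))\<^sup>2 - (norm (rtB w))\<^sup>2)
      + 1/2 * (I1 x - I1 w) + 1/2 * (I3 x - I3 w)"
    unfolding energy_def p_def r_def I1_def I3_def by (simp add: algebra_simps)
  moreover have "\<tau> * ((G + H * Y + onorm N / 2 * S) * S)
      \<le> \<tau> * (G\<^sup>2 / 2 + (1 + H + onorm N) + H / a2) * (1 + energy x y \<tau> + energy y w \<tau>)"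
    using mult_left_mono[OF *, of \<tau>] \<tau> by (simp add: mult.assoc add.assoc)
  ultimately show ?thesis using th by linarith
qed

text \<open>Gronwall is applied with \<open>h = \<tau> * K\<close>. As
  \<open>real j * \<tau> \<le> T\<close>, the exponent is at most \<open>4 * (T * K)\<close>, so the
  bound is the same for all admissible steps. The threshold \<open>n0\<close> ensures
  \<open>\<tau> * K \<le> 1/2\<close>.\<close>

lemma scheme_bounded:
  assumes T: "0 < T" and F: "\<And>t. t \<in> {0..T} \<Longrightarrow> norm (f t) \<le> F"
  obtains r n0 where "0 \<le> r"
    "\<And>n \<tau> u k. n > 1 \<Longrightarrow> n \<ge> n0 \<Longrightarrow> \<tau> = T / real n \<Longrightarrow>
       solves_scheme \<psi>1 \<psi>2 \<psi>3 a1 a2 A rtA DB B C N M f \<tau> n u \<Longrightarrow>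
       norm (rtB (u 0)) \<le> R \<Longrightarrow> norm (rtB (u 1)) \<le> R \<Longrightarrow> norm ((u 1 - u 0) /\<^sub>R \<tau>) \<le> R \<Longrightarrow>
       k \<le> n \<Longrightarrow> norm (rtB (u k)) \<le> r"
proof -
  define K where "K = (\<mu> + F)\<^sup>2 / 2 + (1 + (c + L * \<kappa>) + onorm N) + (c + L * \<kappa>) / a2"
  have K: "0 \<le> K"
    using consts_nonneg onorm_pos_le[OF N] a2_pos by (simp add: K_def add_nonneg_nonneg)
  \<comment> \<open>\<open>R\<close> is an arbitrary real, whereas the energy bound asks for a
    nonnegative radius; hence the absolute value.\<close>
  obtain E0 where E0: "\<And>x y \<tau>. x \<in> DB \<Longrightarrow> y \<in> DB \<Longrightarrow> norm (rtB x) \<le> \<bar>R\<bar> \<Longrightarrow>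
      norm (rtB y) \<le> \<bar>R\<bar> \<Longrightarrow> norm ((x - y) /\<^sub>R \<tau>) \<le> \<bar>R\<bar> \<Longrightarrow> energy x y \<tau> \<le> E0"
    using energy_bound[of "\<bar>R\<bar>"] by auto
  define Q where "Q = (1 + E0) * exp (4 * (T * K))"
  define n0 where "n0 = nat \<lceil>2 * T * K\<rceil>"
  show ?thesis
  \<comment> \<open>The sign of \<open>Q\<close> is not known before a solution is given; the
    maximum with \<open>0\<close> makes the radius nonnegative in any case.\<close>
  proof (rule that[of "sqrt (max 0 (2 * Q / a2))" n0])
    fix n \<tau> u k
    assume n: "n > 1" "n \<ge> n0" and \<tau>: "\<tau> = T / real n"
      and sol: "solves_scheme \<psi>1 \<psi>2 \<psi>3 a1 a2 A rtA DB B C N M f \<tau> n u"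
      and R: "norm (rtB (u 0)) \<le> R" "norm (rtB (u 1)) \<le> R" "norm ((u 1 - u 0) /\<^sub>R \<tau>) \<le> R"
      and k: "k \<le> n"
    have \<tau>0: "\<tau> > 0" using T n \<tau> by simp
    have uD: "u j \<in> DB" if "j \<le> n" for j
      using sol that by (simp add: solves_scheme_def)
    define E where "E j = energy (u (j + 1)) (u j) \<tau>" for j
    have "2 * T * K \<le> real n0" unfolding n0_def by linarith
    also have "\<dots> \<le> real n" using n by simp
    finally have small: "\<tau> * K \<le> 1/2" using n by (simp add: \<tau> field_simps)
    have "R \<le> \<bar>R\<bar>" by simp
    then have E_0: "E 0 \<le> E0"
      unfolding E_def using R n by (intro E0 uD) (auto intro: order_trans)
    have Q: "E j \<le> Q" if j: "j \<le> n - 1" for j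
    proof -
      have "E j \<le> (1 + E 0) * exp (4 * (\<tau> * K) * real j)"
      proof (rule discrete_gronwall[where m = "n - 1"])
        show "0 \<le> E i" for i unfolding E_def by (rule energy_nonneg)
        show "0 \<le> \<tau> * K" using \<tau>0 K by simp
        fix i assume i: "1 \<le> i" "i \<le> n - 1"
        have "real i * \<tau> \<in> {0..T}"
          using i \<tau>0 T by (auto simp: \<tau> field_simps)
        then have Fi: "norm (f (real i * \<tau>)) \<le> F" by (rule F)
        have "energy (u (i + 1)) (u i) \<tau> \<le> energy (u i) (u (i - 1)) \<tau>
            + \<tau> * K * (1 + energy (u (i + 1)) (u i) \<tau> + energy (u i) (u (i - 1)) \<tau>)"
          unfolding K_def
        proof (rule energy_step[OF \<tau>0 _ _ _ _ Fi])
          show "u (i + 1) \<in> DB" "u i \<in> DB" "u (i - 1) \<in> DB"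
            using i n by (auto intro: uD)
        qed (use sol i in \<open>simp add: solves_scheme_def Let_def\<close>)
        then show "E i \<le> E (i - 1) + \<tau> * K * (1 + E i + E (i - 1))"
          using i by (simp add: E_def)
      qed (use small j in auto)
      also have "\<dots> \<le> (1 + E0) * exp (4 * (T * K))"
      proof (rule mult_mono)
        have "real j * \<tau> \<le> T" using j n T by (simp add: \<tau> field_simps)
        then have "(real j * \<tau>) * K \<le> T * K" using K by (rule mult_right_mono)
        then show "exp (4 * (\<tau> * K) * real j) \<le> exp (4 * (T * K))"
          by (simp add: mult_ac)
        have "0 \<le> E 0" unfolding E_def by (rule energy_nonneg)
        then show "0 \<le> 1 + E0" using E_0 by simp
      qed (use E_0 in auto)
      finally show ?thesis by (simp add: Q_def)
    qed
    \<comment> \<open>The last layer \<open>n\<close> occurs only as the upper layer, in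
      \<open>E (n - 1)\<close>; every other layer \<open>k\<close> is the lower layer of
      \<open>E k\<close>.\<close>
    have "a2 / 2 * (norm (rtB (u k)))\<^sup>2 \<le> Q"
    proof (cases "k = n")
      case True
      then show ?thesis
        using rtB_le_energy(1)[of "u n" "u (n - 1)" \<tau>] Q[of "n - 1"] n by (simp add: E_def)
    next
      case False
      then have "k \<le> n - 1" using k by simp
      then show ?thesis
        using rtB_le_energy(2)[of "u k" "u (k + 1)" \<tau>] Q[of k] by (simp add: E_def)
    qed
    then have "(norm (rtB (u k)))\<^sup>2 \<le> max 0 (2 * Q / a2)"
      using a2_pos by (simp add: field_simps le_max_iff_disj)
    then show "norm (rtB (u k)) \<le> sqrt (max 0 (2 * Q / a2))"
      by (rule real_le_rsqrt)
  qed simp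
qed

section \<open>Fixed-point form of the scheme and contraction of the iteration\<close>

text \<open>The scheme is multiplied by \<open>\<tau>\<^sup>2\<close> and
  \<open>x = 2 *\<^sub>R v - w\<close> is inserted. The difference of \<open>\<psi>2\<close> is
  split: its value at the new layer goes into the operator, its value at the old layer stays on the
  right. Thus the exact average is a fixed point of the iteration.\<close>

lemma scheme_fixed_point:
  assumes \<tau>: "\<tau> > 0" and D: "x \<in> DB" "w \<in> DB"
    and eq: "(x - 2 *\<^sub>R y + w) /\<^sub>R \<tau>\<^sup>2
       + a1 *\<^sub>R B ((x - w) /\<^sub>R (2 * \<tau>)) + a2 *\<^sub>R B ((x + w) /\<^sub>R 2)
       + mean_value \<psi>1 ((norm (rtA w))\<^sup>2) ((norm (rtA x))\<^sup>2) *\<^sub>R A ((x + w) /\<^sub>R 2)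
       + ((\<psi>2 ((norm (rtA x))\<^sup>2) - \<psi>2 ((norm (rtA w))\<^sup>2)) / (2 * \<tau>)) *\<^sub>R A ((x + w) /\<^sub>R 2)
       + mean_value \<psi>3 ((norm w)\<^sup>2) ((norm x)\<^sup>2) *\<^sub>R ((x + w) /\<^sub>R 2)
       + C y + N ((x - w) /\<^sub>R (2 * \<tau>)) + M y = g"
  defines "v \<equiv> (x + w) /\<^sub>R 2"
  shows "iter_op \<psi>1 \<psi>2 \<psi>3 a1 a2 A rtA B \<tau> w v v
    = (1/2 * \<tau> * \<psi>2 ((norm (rtA w))\<^sup>2)) *\<^sub>R A v - \<tau> *\<^sub>R N v
      + (\<tau> *\<^sub>R (\<tau> *\<^sub>R g - \<tau> *\<^sub>R M y + N w - \<tau> *\<^sub>R C y) + (\<tau> * a1) *\<^sub>R B w + 2 *\<^sub>R y)"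
proof -
  have vD: "v \<in> DB" using D by (simp add: v_def)
  have x: "x = 2 *\<^sub>R v - w" by (simp add: v_def)
  have d: "(x - w) /\<^sub>R (2 * \<tau>) = (v - w) /\<^sub>R \<tau>"
  proof -
    have "x - w = 2 *\<^sub>R (v - w)"
      unfolding x by (simp add: scaleR_diff_right scaleR_2)
    then show ?thesis by simp
  qed
  have Bd: "B ((v - w) /\<^sub>R \<tau>) = (B v - B w) /\<^sub>R \<tau>"
    using vD D lin_B by (simp add: linear_op_scale linear_op_diff)
  have Nd: "N ((v - w) /\<^sub>R \<tau>) = (N v - N w) /\<^sub>R \<tau>"
    using bounded_linear.linear[OF N] by (simp add: linear_scale linear_diff)
  have s: "(x - 2 *\<^sub>R y + w) /\<^sub>R \<tau>\<^sup>2 = (2 *\<^sub>R v - 2 *\<^sub>R y) /\<^sub>R \<tau>\<^sup>2"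
    unfolding x by simp
  define m1 where "m1 = mean_value \<psi>1 ((norm (rtA w))\<^sup>2) ((norm (rtA x))\<^sup>2)"
  define m3 where "m3 = mean_value \<psi>3 ((norm w)\<^sup>2) ((norm x)\<^sup>2)"
  define p where "p = \<psi>2 ((norm (rtA x))\<^sup>2)"
  define p' where "p' = \<psi>2 ((norm (rtA w))\<^sup>2)"
  have "\<tau>\<^sup>2 *\<^sub>R g = \<tau>\<^sup>2 *\<^sub>R ((2 *\<^sub>R v - 2 *\<^sub>R y) /\<^sub>R \<tau>\<^sup>2
       + a1 *\<^sub>R ((B v - B w) /\<^sub>R \<tau>) + a2 *\<^sub>R B v + m1 *\<^sub>R A v
       + ((p - p') / (2 * \<tau>)) *\<^sub>R A v + m3 *\<^sub>R v + C y + (N v - N w) /\<^sub>R \<tau> + M y)"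
    using eq unfolding s d Bd Nd v_def[symmetric] m1_def m3_def p_def p'_def by simp
  also have "\<dots> = (2 *\<^sub>R v - 2 *\<^sub>R y) + (\<tau> * a1) *\<^sub>R (B v - B w) + (\<tau>\<^sup>2 * a2) *\<^sub>R B v
      + (\<tau>\<^sup>2 * m1) *\<^sub>R A v + (\<tau> / 2 * (p - p')) *\<^sub>R A v + (\<tau>\<^sup>2 * m3) *\<^sub>R v + \<tau>\<^sup>2 *\<^sub>R C y
      + \<tau> *\<^sub>R (N v - N w) + \<tau>\<^sup>2 *\<^sub>R M y"
  proof -
    have inv: "\<tau> * \<tau> * (inverse \<tau> * inverse \<tau>) = 1" "\<tau> * \<tau> * inverse \<tau> = \<tau>"
      "\<tau> * \<tau> * (a1 * inverse \<tau>) = \<tau> * a1"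
      using \<tau> by (simp_all add: field_simps)
    show ?thesis
      using \<tau> by (simp add: scaleR_add_right power2_eq_square) (simp only: inv scaleR_one)
  qed
  finally have "(2 + \<tau>\<^sup>2 * m3) *\<^sub>R v + (\<tau> * (a1 + \<tau> * a2)) *\<^sub>R B v
        + (\<tau> * (\<tau> * m1 + 1/2 * p)) *\<^sub>R A v
      = (1/2 * \<tau> * p') *\<^sub>R A v - \<tau> *\<^sub>R N v
      + (\<tau> *\<^sub>R (\<tau> *\<^sub>R g - \<tau> *\<^sub>R M y + N w - \<tau> *\<^sub>R C y) + (\<tau> * a1) *\<^sub>R B w + 2 *\<^sub>R y)"
    by (simp add: algebra_simps power2_eq_square diff_divide_distrib)
  then show ?thesis
    unfolding iter_op_def Let_def x[symmetric] m1_def m3_def p_def p'_def .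
qed

text \<open>
  The difference \<open>v - z\<close> of the fixed point and the new iterate is tested with itself. The right-hand
  side is of order \<open>\<tau> \<parallel>B\<^sup>1\<^sup>/\<^sup>2 (v - w)\<parallel> \<parallel>v - z\<parallel>\<close>, and \<open>2 \<parallel>v - z\<parallel>\<^sup>2 + \<tau> a\<^sub>1 \<parallel>B\<^sup>1\<^sup>/\<^sup>2 (v - z)\<parallel>\<^sup>2\<close> on the left
  absorbs the factor \<open>\<parallel>v - z\<parallel>\<close> at the price of half a power of \<open>\<tau>\<close>.
\<close>

lemma iteration_step:
  assumes "0 \<le> \<rho>" "0 \<le> T"
  obtains K where "0 \<le> K"
    "\<And>\<tau> u' v w z h. 0 < \<tau> \<Longrightarrow> \<tau> \<le> T \<Longrightarrow> u' \<in> DB \<Longrightarrow> v \<in> DB \<Longrightarrow> w \<in> DB \<Longrightarrow> z \<in> DB \<Longrightarrow>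
       norm (rtB u') \<le> \<rho> \<Longrightarrow> norm (rtB v) \<le> \<rho> \<Longrightarrow>
       norm (rtB (2 *\<^sub>R v - u')) \<le> \<rho> \<Longrightarrow> norm (rtB (2 *\<^sub>R w - u')) \<le> \<rho> \<Longrightarrow>
       iter_op \<psi>1 \<psi>2 \<psi>3 a1 a2 A rtA B \<tau> u' v v
         = (1/2 * \<tau> * \<psi>2 ((norm (rtA u'))\<^sup>2)) *\<^sub>R A v - \<tau> *\<^sub>R N v + h \<Longrightarrow>
       iter_op \<psi>1 \<psi>2 \<psi>3 a1 a2 A rtA B \<tau> u' w z
         = (1/2 * \<tau> * \<psi>2 ((norm (rtA u'))\<^sup>2)) *\<^sub>R A w - \<tau> *\<^sub>R N w + h \<Longrightarrow>
       (norm (rtB (v - z)))\<^sup>2 \<le> K * \<tau> * (norm (rtB (v - w)))\<^sup>2"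
proof -
  obtain K1 where K1: "K1-lipschitz_on {0..(\<kappa>A * \<rho>)\<^sup>2} \<psi>1"
    using C2_on_nonneg_lipschitz C2(1) by blast
  obtain K2 where K2: "K2-lipschitz_on {0..(\<kappa>A * \<rho>)\<^sup>2} \<psi>2"
    using C2_on_nonneg_lipschitz C2(2) by blast
  obtain K3 where K3: "K3-lipschitz_on {0..(\<kappa> * \<rho>)\<^sup>2} \<psi>3"
    using C2_on_nonneg_lipschitz C2(3) by blast
  note K_nonneg = K1[THEN lipschitz_on_nonneg] K2[THEN lipschitz_on_nonneg]
    K3[THEN lipschitz_on_nonneg]
  define P where "P = \<psi>2 ((\<kappa>A * \<rho>)\<^sup>2)"
  \<comment> \<open>The four summands bound the four terms of \<open>g\<close> below, divided by
    \<open>\<tau>\<close> and by the error norm \<open>dB\<close>. Any further factor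
    \<open>\<tau>\<close> is replaced by \<open>T\<close>, so that \<open>c0\<close> does not depend
    on the step.\<close>
  define c0 where "c0 = P / 2 * b + onorm N * \<kappa> + T * (K3 * (4 * \<kappa>\<^sup>2 * \<rho>)) * (\<kappa> * \<rho>)
    + (T * K1 + K2 / 2) * (4 * \<kappa>A\<^sup>2 * \<rho>) * (b * \<rho>)"
  show ?thesis
  proof (rule that[of "c0\<^sup>2 / (8 * a1)"])
    fix \<tau> u' v w z h
    assume \<tau>: "0 < \<tau>" "\<tau> \<le> T" and D: "u' \<in> DB" "v \<in> DB" "w \<in> DB" "z \<in> DB"
      and \<rho>: "norm (rtB u') \<le> \<rho>" "norm (rtB v) \<le> \<rho>"
        "norm (rtB (2 *\<^sub>R v - u')) \<le> \<rho>" "norm (rtB (2 *\<^sub>R w - u')) \<le> \<rho>"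
      and eqs: "iter_op \<psi>1 \<psi>2 \<psi>3 a1 a2 A rtA B \<tau> u' v v
          = (1/2 * \<tau> * \<psi>2 ((norm (rtA u'))\<^sup>2)) *\<^sub>R A v - \<tau> *\<^sub>R N v + h"
        "iter_op \<psi>1 \<psi>2 \<psi>3 a1 a2 A rtA B \<tau> u' w z
          = (1/2 * \<tau> * \<psi>2 ((norm (rtA u'))\<^sup>2)) *\<^sub>R A w - \<tau> *\<^sub>R N w + h"
    define p where "p = 2 *\<^sub>R v - u'"
    define r where "r = 2 *\<^sub>R w - u'"
    define \<gamma> where "\<gamma> y = (norm (rtA y))\<^sup>2" for y
    define s1 where "s1 y = mean_value \<psi>1 (\<gamma> u') (\<gamma> y)" for y
    define s3 where "s3 y = mean_value \<psi>3 ((norm u')\<^sup>2) ((norm y)\<^sup>2)" for y :: 'h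
    define bb where "bb y = \<tau> * s1 y + 1/2 * \<psi>2 (\<gamma> y)" for y
    define e where "e = v - z"
    define d where "d = v - w"
    define dB where "dB = norm (rtB d)"
    \<comment> \<open>The iteration operator depends on the iterate. The new error \<open>e\<close>
      is kept under the operator with the coefficients at \<open>r\<close>, and the change of
      coefficients from \<open>r\<close> to \<open>p\<close> acts on the bounded fixed point
      \<open>v\<close>; \<open>g\<close> is the resulting right-hand side.\<close>
    define g where "g = (1/2 * \<tau> * \<psi>2 (\<gamma> u')) *\<^sub>R A d - \<tau> *\<^sub>R N d
      - (\<tau>\<^sup>2 * (s3 p - s3 r)) *\<^sub>R v - (\<tau> * (bb p - bb r)) *\<^sub>R A v"
    have D': "p \<in> DB" "r \<in> DB" "e \<in> DB" "d \<in> DB"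
      unfolding p_def r_def e_def d_def using D by simp_all
    have nrtA: "norm (rtA y) \<le> \<kappa>A * \<rho>" and nn: "norm y \<le> \<kappa> * \<rho>"
      if "y \<in> DB" "norm (rtB y) \<le> \<rho>" for y
      using norm_rtA[OF that(1)] norm_DB[OF that(1)]
        mult_left_mono[OF that(2) consts_nonneg(4)] mult_left_mono[OF that(2) consts_nonneg(3)]
      by linarith+
    have \<rho>pr: "norm (rtB p) \<le> \<rho>" "norm (rtB r) \<le> \<rho>" using \<rho> by (auto simp: p_def r_def)
    have sq: "\<gamma> y \<in> {0..(\<kappa>A * \<rho>)\<^sup>2}" "(norm y)\<^sup>2 \<in> {0..(\<kappa> * \<rho>)\<^sup>2}"
      if "y \<in> DB" "norm (rtB y) \<le> \<rho>" for y
      using power_mono[OF nrtA[OF that], of 2] power_mono[OF nn[OF that], of 2]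
      by (simp_all add: \<gamma>_def)
    note \<gamma>_mem = sq(1)[OF D(1) \<rho>(1)] sq(1)[OF D'(1) \<rho>pr(1)] sq(1)[OF D'(2) \<rho>pr(2)]
    note n_mem = sq(2)[OF D(1) \<rho>(1)] sq(2)[OF D'(1) \<rho>pr(1)] sq(2)[OF D'(2) \<rho>pr(2)]
    have pr: "p - r = 2 *\<^sub>R d" by (simp add: p_def r_def d_def algebra_simps)
    have "rtA p - rtA r = 2 *\<^sub>R rtA d"
      using D' lin_rtA by (metis pr linear_op_diff linear_op_scale)
    then have "norm (rtA p - rtA r) \<le> 2 * (\<kappa>A * dB)"
      using norm_rtA[OF D'(4)] by (simp add: dB_def)
    from norm_power2_diff_le[OF this nrtA[OF D'(1) \<rho>pr(1)] nrtA[OF D'(2) \<rho>pr(2)]]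
    have d\<gamma>: "\<bar>\<gamma> p - \<gamma> r\<bar> \<le> 4 * \<kappa>A\<^sup>2 * \<rho> * dB"
      by (simp add: \<gamma>_def power2_eq_square mult_ac)
    have "norm (p - r) \<le> 2 * (\<kappa> * dB)"
      using norm_DB[OF D'(4)] by (simp add: pr dB_def)
    from norm_power2_diff_le[OF this nn[OF D'(1) \<rho>pr(1)] nn[OF D'(2) \<rho>pr(2)]]
    have dn: "\<bar>(norm p)\<^sup>2 - (norm r)\<^sup>2\<bar> \<le> 4 * \<kappa>\<^sup>2 * \<rho> * dB"
      by (simp add: power2_eq_square mult_ac)
    have "\<bar>s1 p - s1 r\<bar> \<le> K1 * \<bar>\<gamma> p - \<gamma> r\<bar>"
      unfolding s1_def by (rule mean_value_lipschitz[OF cont(1) K1 \<gamma>_mem])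
    also have "\<dots> \<le> K1 * (4 * \<kappa>A\<^sup>2 * \<rho> * dB)"
      using d\<gamma> K_nonneg by (intro mult_left_mono)
    finally have ds1: "\<bar>s1 p - s1 r\<bar> \<le> K1 * (4 * \<kappa>A\<^sup>2 * \<rho> * dB)" .
    have "\<bar>\<psi>2 (\<gamma> p) - \<psi>2 (\<gamma> r)\<bar> \<le> K2 * \<bar>\<gamma> p - \<gamma> r\<bar>"
      using lipschitz_onD[OF K2 \<gamma>_mem(2,3)] by (simp add: dist_real_def)
    also have "\<dots> \<le> K2 * (4 * \<kappa>A\<^sup>2 * \<rho> * dB)"
      using d\<gamma> K_nonneg by (intro mult_left_mono)
    finally have ds2: "\<bar>\<psi>2 (\<gamma> p) - \<psi>2 (\<gamma> r)\<bar> \<le> K2 * (4 * \<kappa>A\<^sup>2 * \<rho> * dB)" .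
    have "\<bar>s3 p - s3 r\<bar> \<le> K3 * \<bar>(norm p)\<^sup>2 - (norm r)\<^sup>2\<bar>"
      unfolding s3_def by (rule mean_value_lipschitz[OF cont(3) K3 n_mem])
    also have "\<dots> \<le> K3 * (4 * \<kappa>\<^sup>2 * \<rho> * dB)"
      using dn K_nonneg by (intro mult_left_mono)
    finally have ds3: "\<bar>s3 p - s3 r\<bar> \<le> K3 * (4 * \<kappa>\<^sup>2 * \<rho> * dB)" .
    have "bb p - bb r = \<tau> * (s1 p - s1 r) + 1/2 * (\<psi>2 (\<gamma> p) - \<psi>2 (\<gamma> r))"
      by (simp add: bb_def algebra_simps)
    then have "\<bar>bb p - bb r\<bar> \<le> \<tau> * \<bar>s1 p - s1 r\<bar> + 1/2 * \<bar>\<psi>2 (\<gamma> p) - \<psi>2 (\<gamma> r)\<bar>"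
      using abs_triangle_ineq[of "\<tau> * (s1 p - s1 r)" "1/2 * (\<psi>2 (\<gamma> p) - \<psi>2 (\<gamma> r))"] \<tau>
      by (simp add: abs_mult)
    also have "\<dots> \<le> T * (K1 * (4 * \<kappa>A\<^sup>2 * \<rho> * dB)) + 1/2 * (K2 * (4 * \<kappa>A\<^sup>2 * \<rho> * dB))"
      using ds1 ds2 \<tau> by (intro add_mono mult_mono) auto
    finally have dbb: "\<bar>bb p - bb r\<bar> \<le> (T * K1 + K2 / 2) * (4 * \<kappa>A\<^sup>2 * \<rho>) * dB"
      by (simp add: algebra_simps)
    have P: "0 \<le> \<psi>2 (\<gamma> u')" "\<psi>2 (\<gamma> u') \<le> P"
      using \<gamma>_mem(1) psi_nonneg(2) mono_onD[OF psi2_mono, of "\<gamma> u'" "(\<kappa>A * \<rho>)\<^sup>2"]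
      by (simp_all add: P_def)
    have nAv: "norm (A v) \<le> b * \<rho>"
      using norm_A[OF D(2)] mult_left_mono[OF \<rho>(2) consts_nonneg(1)] by linarith
    have "\<psi>2 (\<gamma> u') / 2 * norm (A d) \<le> P / 2 * (b * dB)"
      using P norm_A[OF D'(4)] by (intro mult_mono) (auto simp: dB_def)
    from mult_left_mono[OF this, of \<tau>]
    have g1: "norm ((1/2 * \<tau> * \<psi>2 (\<gamma> u')) *\<^sub>R A d) \<le> \<tau> * (P / 2 * (b * dB))"
      using \<tau> P by (simp add: abs_mult)
    have "norm (N d) \<le> onorm N * (\<kappa> * dB)"
      using onorm[OF N, of d] mult_left_mono[OF norm_DB[OF D'(4)] onorm_pos_le[OF N]]
      by (simp add: dB_def)
    from mult_left_mono[OF this, of \<tau>]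
    have g2: "norm (\<tau> *\<^sub>R N d) \<le> \<tau> * (onorm N * (\<kappa> * dB))"
      using \<tau> by simp
    have "\<tau> * \<bar>s3 p - s3 r\<bar> * norm v \<le> T * (K3 * (4 * \<kappa>\<^sup>2 * \<rho> * dB)) * (\<kappa> * \<rho>)"
      using \<tau> order_trans[OF abs_ge_zero ds3]
      by (intro mult_mono ds3 nn[OF D(2) \<rho>(2)] mult_nonneg_nonneg[of T]) auto
    from mult_left_mono[OF this, of \<tau>]
    have g3: "norm ((\<tau>\<^sup>2 * (s3 p - s3 r)) *\<^sub>R v)
        \<le> \<tau> * (T * (K3 * (4 * \<kappa>\<^sup>2 * \<rho> * dB)) * (\<kappa> * \<rho>))"
      using \<tau> by (simp add: abs_mult power2_eq_square mult.assoc)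
    have "\<bar>bb p - bb r\<bar> * norm (A v)
        \<le> (T * K1 + K2 / 2) * (4 * \<kappa>A\<^sup>2 * \<rho>) * dB * (b * \<rho>)"
      using order_trans[OF abs_ge_zero dbb] by (intro mult_mono dbb nAv) auto
    from mult_left_mono[OF this, of \<tau>]
    have g4: "norm ((\<tau> * (bb p - bb r)) *\<^sub>R A v)
        \<le> \<tau> * ((T * K1 + K2 / 2) * (4 * \<kappa>A\<^sup>2 * \<rho>) * dB * (b * \<rho>))"
      using \<tau> by (simp add: abs_mult mult.assoc)
    have "norm g \<le> norm ((1/2 * \<tau> * \<psi>2 (\<gamma> u')) *\<^sub>R A d) + norm (\<tau> *\<^sub>R N d)
        + norm ((\<tau>\<^sup>2 * (s3 p - s3 r)) *\<^sub>R v) + norm ((\<tau> * (bb p - bb r)) *\<^sub>R A v)"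
      unfolding g_def by (intro order_trans[OF norm_triangle_ineq4] add_mono order_refl)
    also have "\<dots> \<le> \<tau> * (c0 * dB)"
      using g1 g2 g3 g4 unfolding c0_def by (simp add: algebra_simps)
    finally have g_le: "norm g \<le> \<tau> * (c0 * dB)" .
    have e1: "(2 + \<tau>\<^sup>2 * s3 p) *\<^sub>R v + (\<tau> * (a1 + \<tau> * a2)) *\<^sub>R B v + (\<tau> * bb p) *\<^sub>R A v
        = (1/2 * \<tau> * \<psi>2 (\<gamma> u')) *\<^sub>R A v - \<tau> *\<^sub>R N v + h"
      using eqs(1) unfolding iter_op_def Let_def p_def s1_def s3_def bb_def \<gamma>_def .
    have e2: "(2 + \<tau>\<^sup>2 * s3 r) *\<^sub>R z + (\<tau> * (a1 + \<tau> * a2)) *\<^sub>R B z + (\<tau> * bb r) *\<^sub>R A z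
        = (1/2 * \<tau> * \<psi>2 (\<gamma> u')) *\<^sub>R A w - \<tau> *\<^sub>R N w + h"
      using eqs(2) unfolding iter_op_def Let_def r_def s1_def s3_def bb_def \<gamma>_def .
    have diffs: "A e = A v - A z" "B e = B v - B z" "A d = A v - A w" "N d = N v - N w"
      using D lin_A lin_B bounded_linear.linear[OF N]
      by (simp_all add: e_def d_def linear_op_diff linear_diff)
    have "(2 + \<tau>\<^sup>2 * s3 r) *\<^sub>R e + (\<tau> * (a1 + \<tau> * a2)) *\<^sub>R B e + (\<tau> * bb r) *\<^sub>R A e
      - g = ((2 + \<tau>\<^sup>2 * s3 p) *\<^sub>R v + (\<tau> * (a1 + \<tau> * a2)) *\<^sub>R B v + (\<tau> * bb p) *\<^sub>R A v
        - ((1/2 * \<tau> * \<psi>2 (\<gamma> u')) *\<^sub>R A v - \<tau> *\<^sub>R N v + h))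
      - ((2 + \<tau>\<^sup>2 * s3 r) *\<^sub>R z + (\<tau> * (a1 + \<tau> * a2)) *\<^sub>R B z + (\<tau> * bb r) *\<^sub>R A z
        - ((1/2 * \<tau> * \<psi>2 (\<gamma> u')) *\<^sub>R A w - \<tau> *\<^sub>R N w + h))"
      unfolding g_def diffs by (simp add: e_def algebra_simps)
    then have "(2 + \<tau>\<^sup>2 * s3 r) *\<^sub>R e + (\<tau> * (a1 + \<tau> * a2)) *\<^sub>R B e + (\<tau> * bb r) *\<^sub>R A e = g"
      unfolding e1 e2 by simp
    then have "inner g e = (2 + \<tau>\<^sup>2 * s3 r) * (norm e)\<^sup>2
        + \<tau> * (a1 + \<tau> * a2) * (norm (rtB e))\<^sup>2 + \<tau> * bb r * \<gamma> e"
      using D' by (auto simp: inner_add_left A_form B_form power2_norm_eq_inner \<gamma>_def)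
    moreover have s_nonneg: "0 \<le> s1 r" "0 \<le> s3 r" "0 \<le> \<psi>2 (\<gamma> r)" "0 \<le> \<gamma> e"
      unfolding s1_def s3_def \<gamma>_def
      by (simp_all add: mean_value_nonneg[OF cont(1) psi_nonneg(1)]
          mean_value_nonneg[OF cont(3) psi_nonneg(3)] psi_nonneg(2))
    moreover have "0 \<le> \<tau> * bb r * \<gamma> e" "0 \<le> \<tau>\<^sup>2 * s3 r * (norm e)\<^sup>2"
      "0 \<le> \<tau> * (\<tau> * a2) * (norm (rtB e))\<^sup>2"
      using s_nonneg \<tau> a2_pos by (simp_all add: bb_def)
    ultimately have "2 * (norm e)\<^sup>2 + \<tau> * a1 * (norm (rtB e))\<^sup>2 \<le> inner g e"
      by (simp add: algebra_simps)
    also have "\<dots> \<le> norm g * norm e" by (rule norm_cauchy_schwarz)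
    also have "\<dots> \<le> \<tau> * (c0 * dB) * norm e"
      by (rule mult_right_mono[OF g_le]) simp
    \<comment> \<open>The square is completed with the weight that cancels
      \<open>2 * (norm e)\<^sup>2\<close> on the left. The remainder carries
      \<open>\<tau>\<^sup>2\<close>, so division by \<open>\<tau> * a1\<close> leaves one factor
      \<open>\<tau>\<close>.\<close>
    also have "\<dots> \<le> 2 * (norm e)\<^sup>2 + (\<tau> * (c0 * dB))\<^sup>2 / 8"
      using zero_le_power2[of "4 * norm e - \<tau> * (c0 * dB)"]
      by (simp add: power2_diff power_mult_distrib field_simps)
    finally have "\<tau> * a1 * (norm (rtB e))\<^sup>2 \<le> \<tau> * (c0\<^sup>2 * \<tau> * dB\<^sup>2 / 8)"
      by (simp add: power_mult_distrib power2_eq_square mult_ac)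
    then show "(norm (rtB (v - z)))\<^sup>2 \<le> c0\<^sup>2 / (8 * a1) * \<tau> * (norm (rtB (v - w)))\<^sup>2"
      using \<tau> a1_pos by (simp add: e_def d_def dB_def field_simps)
  qed (use a1_pos in simp)
qed

text \<open>The constant of one step is valid only on a ball. The induction closes because the
  errors do not grow: every iterate then stays in that ball, and the next step contracts
  again.\<close>

lemma iteration_converges:
  assumes T: "0 < T" and F: "\<And>t. t \<in> {0..T} \<Longrightarrow> norm (f t) \<le> F"
  shows "\<exists>q n0. 0 \<le> q \<and> q < 1 \<and>
    (\<forall>n \<tau> u k v. n > 1 \<and> n \<ge> n0 \<and> \<tau> = T / real n \<and>
       solves_scheme \<psi>1 \<psi>2 \<psi>3 a1 a2 A rtA DB B C N M f \<tau> n u \<and>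
       norm (rtB (u 0)) \<le> R \<and> norm (rtB (u 1)) \<le> R \<and> norm ((u 1 - u 0) /\<^sub>R \<tau>) \<le> R \<and>
       1 \<le> k \<and> k \<le> n - 1 \<and>
       is_iteration \<psi>1 \<psi>2 \<psi>3 a1 a2 A rtA DB B C N M f \<tau> u k v \<longrightarrow>
       (\<forall>m. norm (rtB ((u (k + 1) + u (k - 1)) /\<^sub>R 2 - v m))
              \<le> q ^ m * norm (rtB ((u (k + 1) + u (k - 1)) /\<^sub>R 2 - v 0))))"
proof -
  obtain r n1 where r: "0 \<le> r" and bound: "\<And>n \<tau> u k. n > 1 \<Longrightarrow> n \<ge> n1 \<Longrightarrow> \<tau> = T / real n \<Longrightarrow>
       solves_scheme \<psi>1 \<psi>2 \<psi>3 a1 a2 A rtA DB B C N M f \<tau> n u \<Longrightarrow>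
       norm (rtB (u 0)) \<le> R \<Longrightarrow> norm (rtB (u 1)) \<le> R \<Longrightarrow> norm ((u 1 - u 0) /\<^sub>R \<tau>) \<le> R \<Longrightarrow>
       k \<le> n \<Longrightarrow> norm (rtB (u k)) \<le> r"
    by (rule scheme_bounded[where R = R, OF T F]) blast+
  \<comment> \<open>The initial error is at most \<open>2 * r\<close>, being a difference of two
    averages of layers. Since \<open>2 *\<^sub>R v m - u (k - 1) = u (k + 1) - 2 *\<^sub>R (x - v
    m)\<close>, the radius needed is \<open>r + 2 * (2 * r)\<close>.\<close>
  have "0 \<le> 5 * r" "0 \<le> T" using r T by auto
  then obtain K where K: "0 \<le> K" and step: "\<And>\<tau> u' v w z h. 0 < \<tau> \<Longrightarrow> \<tau> \<le> T \<Longrightarrow>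
       u' \<in> DB \<Longrightarrow> v \<in> DB \<Longrightarrow> w \<in> DB \<Longrightarrow> z \<in> DB \<Longrightarrow>
       norm (rtB u') \<le> 5 * r \<Longrightarrow> norm (rtB v) \<le> 5 * r \<Longrightarrow>
       norm (rtB (2 *\<^sub>R v - u')) \<le> 5 * r \<Longrightarrow> norm (rtB (2 *\<^sub>R w - u')) \<le> 5 * r \<Longrightarrow>
       iter_op \<psi>1 \<psi>2 \<psi>3 a1 a2 A rtA B \<tau> u' v v
         = (1/2 * \<tau> * \<psi>2 ((norm (rtA u'))\<^sup>2)) *\<^sub>R A v - \<tau> *\<^sub>R N v + h \<Longrightarrow>
       iter_op \<psi>1 \<psi>2 \<psi>3 a1 a2 A rtA B \<tau> u' w z
         = (1/2 * \<tau> * \<psi>2 ((norm (rtA u'))\<^sup>2)) *\<^sub>R A w - \<tau> *\<^sub>R N w + h \<Longrightarrow>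
       (norm (rtB (v - z)))\<^sup>2 \<le> K * \<tau> * (norm (rtB (v - w)))\<^sup>2"
    by (rule iteration_step) blast
  \<comment> \<open>From \<open>n \<ge> 4 * K * T\<close> follows
    \<open>K * \<tau> \<le> 1/4\<close>, the square of the ratio \<open>1/2\<close>;
    \<open>n1\<close> is the threshold of the a priori bound.\<close>
  define n0 where "n0 = max n1 (nat \<lceil>4 * K * T\<rceil>)"
  have conv: "norm (rtB ((u (k + 1) + u (k - 1)) /\<^sub>R 2 - v m))
      \<le> (1/2) ^ m * norm (rtB ((u (k + 1) + u (k - 1)) /\<^sub>R 2 - v 0))"
    if n: "n > 1" "n \<ge> n0" and \<tau>: "\<tau> = T / real n"
      and sol: "solves_scheme \<psi>1 \<psi>2 \<psi>3 a1 a2 A rtA DB B C N M f \<tau> n u"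
      and R: "norm (rtB (u 0)) \<le> R" "norm (rtB (u 1)) \<le> R" "norm ((u 1 - u 0) /\<^sub>R \<tau>) \<le> R"
      and k: "1 \<le> k" "k \<le> n - 1"
      and iter: "is_iteration \<psi>1 \<psi>2 \<psi>3 a1 a2 A rtA DB B C N M f \<tau> u k v"
    for n \<tau> u k v m
  proof -
    define x where "x = (u (k + 1) + u (k - 1)) /\<^sub>R 2"
    have \<tau>0: "0 < \<tau>" "\<tau> \<le> T" using T n by (auto simp: \<tau> field_simps)
    have "4 * K * T \<le> real n" using n unfolding n0_def by linarith
    then have small: "K * \<tau> \<le> (1/2)\<^sup>2" using n by (simp add: \<tau> power2_eq_square field_simps)
    have D: "u (k + 1) \<in> DB" "u k \<in> DB" "u (k - 1) \<in> DB"
      using sol k n by (auto simp: solves_scheme_def)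
    have b: "norm (rtB (u j)) \<le> r" if "j \<le> n" for j
      using bound[OF n(1) _ \<tau> sol R that] n by (simp add: n0_def)
    have b3: "norm (rtB (u (k + 1))) \<le> r" "norm (rtB (u k)) \<le> r" "norm (rtB (u (k - 1))) \<le> r"
      using k n by (auto intro!: b)
    have avg: "norm (rtB ((y + y') /\<^sub>R 2)) \<le> r"
      if "y \<in> DB" "y' \<in> DB" "norm (rtB y) \<le> r" "norm (rtB y') \<le> r" for y y'
      using that norm_triangle_ineq[of "rtB y" "rtB y'"]
      by (simp add: linear_op_scale[OF lin_rtB] linear_op_add[OF lin_rtB])
    have xD: "x \<in> DB" and xr: "norm (rtB x) \<le> r"
      using D avg b3 by (auto simp: x_def)
    have v0: "v 0 = (u k + u (k - 1)) /\<^sub>R 2" and vS: "\<And>m. v (Suc m) \<in> DB"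
      using iter by (auto simp: is_iteration_def)
    have vD: "v m \<in> DB" for m
      using v0 vS D by (cases m) auto
    have "norm (rtB (x - v 0)) \<le> norm (rtB x) + norm (rtB (v 0))"
      using xD vD by (simp add: linear_op_diff[OF lin_rtB] norm_triangle_ineq4)
    moreover have "norm (rtB (v 0)) \<le> r"
      unfolding v0 using D b3 by (intro avg)
    ultimately have e0: "norm (rtB (x - v 0)) \<le> 2 * r"
      using xr by linarith
    have x2: "2 *\<^sub>R x - u (k - 1) = u (k + 1)"
      by (simp add: x_def)
    have r5: "norm (rtB (u (k - 1))) \<le> 5 * r" "norm (rtB x) \<le> 5 * r"
      "norm (rtB (2 *\<^sub>R x - u (k - 1))) \<le> 5 * r"
      unfolding x2 using b3 xr r by linarith+
    define h where "h = iter_rhs a1 B C N M f \<tau> u k"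
    have fixp: "iter_op \<psi>1 \<psi>2 \<psi>3 a1 a2 A rtA B \<tau> (u (k - 1)) x x
        = (1/2 * \<tau> * \<psi>2 ((norm (rtA (u (k - 1))))\<^sup>2)) *\<^sub>R A x - \<tau> *\<^sub>R N x + h"
      unfolding x_def h_def iter_rhs_def Let_def
      by (rule scheme_fixed_point[OF \<tau>0(1) D(1,3)])
        (use sol k in \<open>simp add: solves_scheme_def Let_def\<close>)
    have "norm (rtB (x - v m)) \<le> (1/2) ^ m * norm (rtB (x - v 0))"
    proof (induction m)
      case (Suc m)
      have "(1/2::real) ^ m \<le> 1" by (rule power_le_one) auto
      then have "norm (rtB (x - v m)) \<le> 2 * r"
        using Suc.IH e0 mult_left_le_one_le[of "norm (rtB (x - v 0))" "(1/2) ^ m"]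
        by simp
      moreover have "2 *\<^sub>R v m - u (k - 1) = u (k + 1) - 2 *\<^sub>R (x - v m)"
        by (simp add: x_def scaleR_diff_right)
      then have "rtB (2 *\<^sub>R v m - u (k - 1)) = rtB (u (k + 1)) - 2 *\<^sub>R rtB (x - v m)"
        using D xD vD by (simp add: linear_op_diff[OF lin_rtB] linear_op_scale[OF lin_rtB])
      ultimately have w: "norm (rtB (2 *\<^sub>R v m - u (k - 1))) \<le> 5 * r"
        using norm_triangle_ineq4[of "rtB (u (k + 1))" "2 *\<^sub>R rtB (x - v m)"] b3 by simp
      have "(norm (rtB (x - v (Suc m))))\<^sup>2 \<le> K * \<tau> * (norm (rtB (x - v m)))\<^sup>2"
      proof (rule step[OF \<tau>0 D(3) xD vD vD r5 w fixp])
        show "iter_op \<psi>1 \<psi>2 \<psi>3 a1 a2 A rtA B \<tau> (u (k - 1)) (v m) (v (Suc m))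
          = (1/2 * \<tau> * \<psi>2 ((norm (rtA (u (k - 1))))\<^sup>2)) *\<^sub>R A (v m) - \<tau> *\<^sub>R N (v m) + h"
          using iter by (simp add: is_iteration_def h_def)
      qed
      also have "\<dots> \<le> (1/2)\<^sup>2 * (norm (rtB (x - v m)))\<^sup>2"
        by (rule mult_right_mono[OF small]) simp
      also have "\<dots> = (1/2 * norm (rtB (x - v m)))\<^sup>2"
        by (rule power_mult_distrib [symmetric])
      finally have "norm (rtB (x - v (Suc m))) \<le> 1/2 * norm (rtB (x - v m))"
        by (rule power2_le_imp_le) simp
      then show ?case using Suc.IH by simp
    qed simp
    then show ?thesis by (simp add: x_def)
  qed
  show ?thesis
    by (intro exI[of _ "1/2"] exI[of _ n0] conjI allI impI; (elim conjE)?;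
        (rule conv; assumption)?) simp_all
qed

end

section \<open>From unbounded operators to the abstract scheme\<close>

text \<open>The a priori bound depends on the data of the two starting layers, so their bound
  \<open>R\<close> is fixed first; \<open>q\<close> and \<open>n0\<close> then serve all
  \<open>n\<close>, \<open>u\<close> and \<open>k\<close> at once.\<close>

theorem theorem7p4:
  fixes A B C N M rtA rtB :: "'h::{real_inner, complete_space} \<Rightarrow> 'h"
    and DA DB DC DrtA DrtB :: "'h set"
    and \<psi>1 \<psi>2 \<psi>3 :: "real \<Rightarrow> real"
    and a0 a1 a2 b0 tbar :: real
    and f :: "real \<Rightarrow> 'h"
  assumes "tbar > 0"
    and "self_adjoint_op DA A" and "positive_definite_op DA A"
    and "self_adjoint_op DB B" and "positive_definite_op DB B"
    and "is_op_sqrt DA A DrtA rtA" and "is_op_sqrt DB B DrtB rtB"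
    and "DB \<subseteq> DA"
    and "b0 > 0" and "\<And>u. u \<in> DB \<Longrightarrow> (norm (A u))\<^sup>2 \<le> b0\<^sup>2 * inner (B u) u"
    and "C2_on_nonneg \<psi>1" and "C2_on_nonneg \<psi>2" and "C2_on_nonneg \<psi>3"
    and "\<And>s. s \<ge> 0 \<Longrightarrow> \<psi>1 s \<ge> 0" and "\<And>s. s \<ge> 0 \<Longrightarrow> \<psi>2 s \<ge> 0" and "\<And>s. s \<ge> 0 \<Longrightarrow> \<psi>3 s \<ge> 0"
    and "mono_on {0..} \<psi>2"
    and "linear_op DC C" and "DA \<subseteq> DC"
    and "a0 > 0" and "\<And>u. u \<in> DA \<Longrightarrow> norm (C u) \<le> a0 * norm (A u)"
    and "bounded_linear N"
    and "\<exists>L. L-lipschitz_on UNIV M"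
    and "a1 > 0" and "a2 > 0"
    and "continuous_on {0..tbar} f"
    and "DA = DrtB"
  shows "\<forall>R. \<exists>q n0. 0 \<le> q \<and> q < 1 \<and>
    (\<forall>n \<tau> u k v. n > 1 \<and> n \<ge> n0 \<and> \<tau> = tbar / real n \<and>
       solves_scheme \<psi>1 \<psi>2 \<psi>3 a1 a2 A rtA DB B C N M f \<tau> n u \<and>
       norm (rtB (u 0)) \<le> R \<and> norm (rtB (u 1)) \<le> R \<and> norm ((u 1 - u 0) /\<^sub>R \<tau>) \<le> R \<and>
       1 \<le> k \<and> k \<le> n - 1 \<and>
       is_iteration \<psi>1 \<psi>2 \<psi>3 a1 a2 A rtA DB B C N M f \<tau> u k v \<longrightarrow>
       (\<forall>m. norm (rtB ((u (k + 1) + u (k - 1)) /\<^sub>R 2 - v m))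
              \<le> q ^ m * norm (rtB ((u (k + 1) + u (k - 1)) /\<^sub>R 2 - v 0))))"
proof
  fix R
  have lin_B: "linear_op DB B" and lin_A: "linear_op DA A"
    using assms(2,4) by (auto intro: self_adjoint_op_linear)
  have sub: "subspace DB" by (rule linear_op_subspace[OF lin_B])
  obtain m where m: "m > 0" "\<And>u. u \<in> DB \<Longrightarrow> m * (norm u)\<^sup>2 \<le> inner (B u) u"
    using assms(5) unfolding positive_definite_op_def by blast
  have B_form: "inner (B x) y = inner (rtB x) (rtB y)" if "x \<in> DB" "y \<in> DB" for x y
    using assms(7) that by (rule is_op_sqrt_form)
  have A_form: "inner (A x) y = inner (rtA x) (rtA y)" if "x \<in> DB" "y \<in> DB" for x y
    using assms(6,8) that by (intro is_op_sqrt_form[of DA A DrtA rtA]) auto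
  \<comment> \<open>Positive definiteness of \<open>B\<close> reads
    \<open>m * (norm u)\<^sup>2 \<le> (norm (rtB u))\<^sup>2\<close>, which gives this embedding
    constant.\<close>
  define \<kappa> where "\<kappa> = 1 / sqrt m"
  have \<kappa>: "0 \<le> \<kappa>" using m(1) by (simp add: \<kappa>_def)
  have norm_DB: "norm x \<le> \<kappa> * norm (rtB x)" if "x \<in> DB" for x
  proof (rule power2_le_imp_le)
    show "(norm x)\<^sup>2 \<le> (\<kappa> * norm (rtB x))\<^sup>2"
      using m(2)[OF that] B_form[OF that that] m(1)
      by (simp add: \<kappa>_def power_divide power_mult_distrib power2_norm_eq_inner field_simps)
  qed (use \<kappa> in simp)
  have norm_A: "norm (A x) \<le> b0 * norm (rtB x)" if "x \<in> DB" for x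
  proof (rule power2_le_imp_le)
    show "(norm (A x))\<^sup>2 \<le> (b0 * norm (rtB x))\<^sup>2"
      using assms(10)[OF that] B_form[OF that that]
      by (simp add: power_mult_distrib power2_norm_eq_inner)
  qed (use assms(9) in simp)
  \<comment> \<open>The constant comes from interpolation:
    \<open>(norm (rtA x))\<^sup>2 = inner (A x) x\<close> is at most
    \<open>norm (A x) * norm x\<close>, and both factors are controlled by
    \<open>norm (rtB x)\<close>.\<close>
  have norm_rtA: "norm (rtA x) \<le> sqrt (b0 * \<kappa>) * norm (rtB x)" if "x \<in> DB" for x
  proof (rule power2_le_imp_le)
    have "(norm (rtA x))\<^sup>2 = inner (A x) x"
      using A_form[OF that that] by (simp add: power2_norm_eq_inner)
    also have "\<dots> \<le> norm (A x) * norm x" by (rule norm_cauchy_schwarz)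
    also have "\<dots> \<le> (b0 * norm (rtB x)) * (\<kappa> * norm (rtB x))"
      using norm_A[OF that] norm_DB[OF that] assms(9) by (intro mult_mono) auto
    also have "\<dots> = (sqrt (b0 * \<kappa>) * norm (rtB x))\<^sup>2"
      using assms(9) \<kappa> by (simp add: power_mult_distrib power2_eq_square)
    finally show "(norm (rtA x))\<^sup>2 \<le> (sqrt (b0 * \<kappa>) * norm (rtB x))\<^sup>2" .
  qed (use assms(9) \<kappa> in simp)
  have norm_C: "norm (C x) \<le> a0 * b0 * norm (rtB x)" if "x \<in> DB" for x
  proof -
    have "norm (C x) \<le> a0 * norm (A x)" using assms(8,21) that by blast
    also have "\<dots> \<le> a0 * (b0 * norm (rtB x))"
      using norm_A[OF that] assms(20) by (intro mult_left_mono) auto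
    finally show ?thesis by (simp add: mult.assoc)
  qed
  obtain L where L: "L-lipschitz_on UNIV M" using assms(23) by blast
  have norm_M: "norm (M x) \<le> norm (M 0) + L * norm x" for x
    using lipschitz_onD[OF L, of x 0] norm_triangle_sub[of "M x" "M 0"] by (simp add: dist_norm)
  interpret operator_scheme A B C N M rtA rtB DB \<psi>1 \<psi>2 \<psi>3 a1 a2 b0 "a0 * b0" \<kappa> "sqrt (b0 * \<kappa>)"
    "norm (M 0)" L
  proof (rule operator_scheme.intro)
    show "linear_op DB A" using lin_A sub assms(8) by (rule linear_op_restrict)
    show "linear_op DB rtB" using assms(7) lin_B by (rule is_op_sqrt_linear)
    show "linear_op DB rtA"
      using is_op_sqrt_linear[OF assms(6) lin_A] sub assms(8) by (rule linear_op_restrict)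
    show "0 \<le> L" using L by (rule lipschitz_on_nonneg)
  qed (use lin_B A_form B_form norm_A norm_C norm_rtA norm_DB norm_M \<kappa> assms in auto)
  have "bounded (f ` {0..tbar})"
    using assms(26) by (intro compact_imp_bounded compact_continuous_image) auto
  then obtain F where "\<And>t. t \<in> {0..tbar} \<Longrightarrow> norm (f t) \<le> F"
    unfolding bounded_iff by blast
  then show "\<exists>q n0. 0 \<le> q \<and> q < 1 \<and>
    (\<forall>n \<tau> u k v. n > 1 \<and> n \<ge> n0 \<and> \<tau> = tbar / real n \<and>
       solves_scheme \<psi>1 \<psi>2 \<psi>3 a1 a2 A rtA DB B C N M f \<tau> n u \<and>
       norm (rtB (u 0)) \<le> R \<and> norm (rtB (u 1)) \<le> R \<and> norm ((u 1 - u 0) /\<^sub>R \<tau>) \<le> R \<and>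
       1 \<le> k \<and> k \<le> n - 1 \<and>
       is_iteration \<psi>1 \<psi>2 \<psi>3 a1 a2 A rtA DB B C N M f \<tau> u k v \<longrightarrow>
       (\<forall>m. norm (rtB ((u (k + 1) + u (k - 1)) /\<^sub>R 2 - v m))
              \<le> q ^ m * norm (rtB ((u (k + 1) + u (k - 1)) /\<^sub>R 2 - v 0))))"
    by (rule iteration_converges[OF assms(1)])
qed

end
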